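(* Let $\mathcal{C}$ be a Cauchy complete $*$-autonomous category (not assumed symmetric) with tensor product $\otimes$ (unit $I$) and dual tensor product $⅋$ (unit $\bot$). Then a right trace on the monoidal category $(\mathcal{C},\otimes,I)$ and a left trace on the monoidal category $(\mathcal{C},⅋,\bot)$ are equivalent: every right $\otimes$-trace on $\mathcal{C}$ determines a left $⅋$-trace on $\mathcal{C}$ and every left $⅋$-trace determines a right $\otimes$-trace, by transport through the duality of $\mathcal{C}$, and these two assignments are mutually inverse.
   Context: Categories are small; Cauchy complete means that all idempotents split. **$*$-autonomous category (non-symmetric).** A monoidal category $(\mathcal{C},\otimes,I)$ with an object $\bot$ such that every object $A$ has objects $A^\bot$ and ${}^\bot A$ with natural bijections $\mathcal{C}(X,A^\bot)\cong\mathcal{C}(A\otimes X,\bot)$ and $\mathcal{C}(X,{}^\bot A)\cong\mathcal{C}(X\otimes A,\bot)$, and such that the canonical maps $A\to{}^\bot(A^\bot)$ and $A\to({}^\bot A)^\bot$ are isomorphisms. Then $(-)^\bot$ and ${}^\bot(-)$ are mutually inverse contravariant equivalences. The dual tensor product is $A⅋B:={}^\bot(B^\bot\otimes A^\bot)\cong({}^\bot B\otimes{}^\bot A)^\bot$; it makes $(\mathcal{C},⅋,\bot)$ a monoidal category, and $(A⅋B)^\bot\cong B^\bot\otimes A^\bot$, ${}^\bot(A⅋B)\cong{}^\bot B\otimes{}^\bot A$. **Right trace.** A right trace on a monoidal category $(\mathcal{C},\boxdot,J,\alpha,\lambda,\rho)$ (here $\boxdot=\otimes$) is a family of functions $\mathrm{Tr}^X_{A,B}\colon\mathcal{C}(A\boxdot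 X,B\boxdot X)\to\mathcal{C}(A,B)$ satisfying: * tightening: $\mathrm{Tr}^X((h\boxdot X)\circ f\circ(g\boxdot X))=h\circ\mathrm{Tr}^X(f)\circ g$; * sliding: $\mathrm{Tr}^X((B\boxdot h)\circ f)=\mathrm{Tr}^Y(f\circ(A\boxdot h))$ for $f\colon A\boxdot X\to B\boxdot Y$, $h\colon Y\to X$; * vanishing: $\mathrm{Tr}^J(f)=\rho_B\circ f\circ\rho_A^{-1}$ and $\mathrm{Tr}^{X\boxdot Y}(f)=\mathrm{Tr}^X(\mathrm{Tr}^Y(\alpha^{-1}_{B,X,Y}\circ f\circ\alpha_{A,X,Y}))$; * superposing: $\mathrm{Tr}^X(\alpha^{-1}_{D,B,X}\circ(g\boxdot f)\circ\alpha_{C,A,X})=g\boxdot\mathrm{Tr}^X(f)$ for $g\colon C\to D$, $f\colon A\boxdot X\to B\boxdot X$. **Left trace.** A left trace on $(\mathcal{C},\boxdot,J)$ (here $\boxdot=⅋$) is a family of functions $\mathcal{C}(X\boxdot A,X\boxdot B)\to\mathcal{C}(A,B)$ satisfying the left-right mirror images of these axioms; that is, it is a right trace for the reversed monoidal product $A\boxdot^{\mathrm{rev}}B=B\boxdot A$. *)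

theory Defs
  imports "HOL-Library.FuncSet"
begin

record ('o, 'm) category_data =
  Obj :: "'o set"
  Arr :: "'m set"
  Dom :: "'m \<Rightarrow> 'o"
  Cod :: "'m \<Rightarrow> 'o"
  Idn :: "'o \<Rightarrow> 'm"  ("\<one>\<index>")
  Comp :: "'m \<Rightarrow> 'm \<Rightarrow> 'm"  (infixr "\<cdot>\<index>" 65)

definition hom :: "('o, 'm, 'x) category_data_scheme \<Rightarrow> 'o \<Rightarrow> 'o \<Rightarrow> 'm set"
  where "hom C A B = {f \<in> Arr C. Dom C f = A \<and> Cod C f = B}"

locale category =
  fixes C :: "('o, 'm, 'x) category_data_scheme" (structure)
  assumes Dom_Obj: "f \<in> Arr C \<Longrightarrow> Dom C f \<in> Obj C"
    and Cod_Obj: "f \<in> Arr C \<Longrightarrow> Cod C f \<in> Obj C"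
    and Idn_hom: "A \<in> Obj C \<Longrightarrow> \<one> A \<in> hom C A A"
    and Comp_hom: "\<lbrakk>f \<in> hom C A B; g \<in> hom C B D\<rbrakk> \<Longrightarrow> g \<cdot> f \<in> hom C A D"
    and Comp_Idn: "f \<in> hom C A B \<Longrightarrow> f \<cdot> \<one> A = f"
    and Idn_Comp: "f \<in> hom C A B \<Longrightarrow> \<one> B \<cdot> f = f"
    and Comp_assoc: "\<lbrakk>f \<in> hom C A B; g \<in> hom C B D; h \<in> hom C D E\<rbrakk>
      \<Longrightarrow> (h \<cdot> g) \<cdot> f = h \<cdot> (g \<cdot> f)"

definition inverse_arrows :: "('o, 'm, 'x) category_data_scheme \<Rightarrow> 'm \<Rightarrow> 'm \<Rightarrow> bool"
  where "inverse_arrows C f g \<longleftrightarrow> f \<in> Arr C \<and> g \<in> hom C (Cod C f) (Dom C f) \<and>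
    g \<cdot>\<^bsub>C\<^esub> f = \<one>\<^bsub>C\<^esub> (Dom C f) \<and> f \<cdot>\<^bsub>C\<^esub> g = \<one>\<^bsub>C\<^esub> (Cod C f)"

definition iso :: "('o, 'm, 'x) category_data_scheme \<Rightarrow> 'm \<Rightarrow> bool"
  where "iso C f \<longleftrightarrow> (\<exists>g. inverse_arrows C f g)"

definition arr_inv :: "('o, 'm, 'x) category_data_scheme \<Rightarrow> 'm \<Rightarrow> 'm"  ("inv\<index> _" [81] 80)
  where "inv\<^bsub>C\<^esub> f = (THE g. inverse_arrows C f g)"

definition cauchy_complete :: "('o, 'm, 'x) category_data_scheme \<Rightarrow> bool"
  where "cauchy_complete C \<longleftrightarrow>
    (\<forall>A \<in> Obj C. \<forall>e \<in> hom C A A. e \<cdot>\<^bsub>C\<^esub> e = e \<longrightarrow>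
      (\<exists>B \<in> Obj C. \<exists>r \<in> hom C A B. \<exists>s \<in> hom C B A.
        s \<cdot>\<^bsub>C\<^esub> r = e \<and> r \<cdot>\<^bsub>C\<^esub> s = \<one>\<^bsub>C\<^esub> B))"

record ('o, 'm) monoidal_data = "('o, 'm) category_data" +
  TenO :: "'o \<Rightarrow> 'o \<Rightarrow> 'o"  (infixr "\<otimes>\<index>" 75)
  TenA :: "'m \<Rightarrow> 'm \<Rightarrow> 'm"  (infixr "\<odot>\<index>" 75)
  Unit :: "'o"
  Assoc :: "'o \<Rightarrow> 'o \<Rightarrow> 'o \<Rightarrow> 'm"
  LUnit :: "'o \<Rightarrow> 'm"
  RUnit :: "'o \<Rightarrow> 'm"

locale monoidal_category = category C
  for C :: "('o, 'm, 'x) monoidal_data_scheme" (structure) +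
  assumes TenO_Obj: "\<lbrakk>A \<in> Obj C; B \<in> Obj C\<rbrakk> \<Longrightarrow> A \<otimes> B \<in> Obj C"
    and TenA_hom: "\<lbrakk>f \<in> hom C A B; g \<in> hom C A' B'\<rbrakk> \<Longrightarrow> f \<odot> g \<in> hom C (A \<otimes> A') (B \<otimes> B')"
    and TenA_Idn: "\<lbrakk>A \<in> Obj C; B \<in> Obj C\<rbrakk> \<Longrightarrow> \<one> A \<odot> \<one> B = \<one> (A \<otimes> B)"
    and TenA_Comp: "\<lbrakk>f \<in> hom C A B; g \<in> hom C B D; f' \<in> hom C A' B'; g' \<in> hom C B' D'\<rbrakk>
      \<Longrightarrow> (g \<cdot> f) \<odot> (g' \<cdot> f') = (g \<odot> g') \<cdot> (f \<odot> f')"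
    and Unit_Obj: "Unit C \<in> Obj C"
    and Assoc_hom: "\<lbrakk>A \<in> Obj C; B \<in> Obj C; D \<in> Obj C\<rbrakk>
      \<Longrightarrow> Assoc C A B D \<in> hom C ((A \<otimes> B) \<otimes> D) (A \<otimes> (B \<otimes> D))"
    and Assoc_iso: "\<lbrakk>A \<in> Obj C; B \<in> Obj C; D \<in> Obj C\<rbrakk> \<Longrightarrow> iso C (Assoc C A B D)"
    and Assoc_nat: "\<lbrakk>f \<in> hom C A A'; g \<in> hom C B B'; h \<in> hom C D D'\<rbrakk>
      \<Longrightarrow> Assoc C A' B' D' \<cdot> ((f \<odot> g) \<odot> h) = (f \<odot> (g \<odot> h)) \<cdot> Assoc C A B D"
    and LUnit_hom: "A \<in> Obj C \<Longrightarrow> LUnit C A \<in> hom C (Unit C \<otimes> A) A"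
    and LUnit_iso: "A \<in> Obj C \<Longrightarrow> iso C (LUnit C A)"
    and LUnit_nat: "f \<in> hom C A B \<Longrightarrow> LUnit C B \<cdot> (\<one> (Unit C) \<odot> f) = f \<cdot> LUnit C A"
    and RUnit_hom: "A \<in> Obj C \<Longrightarrow> RUnit C A \<in> hom C (A \<otimes> Unit C) A"
    and RUnit_iso: "A \<in> Obj C \<Longrightarrow> iso C (RUnit C A)"
    and RUnit_nat: "f \<in> hom C A B \<Longrightarrow> RUnit C B \<cdot> (f \<odot> \<one> (Unit C)) = f \<cdot> RUnit C A"
    and pentagon: "\<lbrakk>A \<in> Obj C; B \<in> Obj C; D \<in> Obj C; E \<in> Obj C\<rbrakk>
      \<Longrightarrow> Assoc C A B (D \<otimes> E) \<cdot> Assoc C (A \<otimes> B) D E =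
          (\<one> A \<odot> Assoc C B D E) \<cdot> Assoc C A (B \<otimes> D) E \<cdot> (Assoc C A B D \<odot> \<one> E)"
    and triangle: "\<lbrakk>A \<in> Obj C; B \<in> Obj C\<rbrakk>
      \<Longrightarrow> (\<one> A \<odot> LUnit C B) \<cdot> Assoc C A (Unit C) B = RUnit C A \<odot> \<one> B"

definition rev_monoidal :: "('o, 'm, 'x) monoidal_data_scheme \<Rightarrow> ('o, 'm) monoidal_data"
  where "rev_monoidal M =
   \<lparr>Obj = Obj M, Arr = Arr M, Dom = Dom M, Cod = Cod M, Idn = Idn M, Comp = Comp M,
    TenO = (\<lambda>A B. B \<otimes>\<^bsub>M\<^esub> A),
    TenA = (\<lambda>f g. g \<odot>\<^bsub>M\<^esub> f),
    Unit = Unit M,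
    Assoc = (\<lambda>A B D. inv\<^bsub>M\<^esub> (Assoc M D B A)),
    LUnit = RUnit M,
    RUnit = LUnit M\<rparr>"

text \<open>A trace is a family \<open>Tr X A B f\<close>. Families are extensional, that is, \<^const>\<open>undefined\<close> outside
  the objects and hom-sets concerned, so that equality of traces is equality in HOL.\<close>

definition trace_families ::
    "('o, 'm, 'x) monoidal_data_scheme \<Rightarrow> ('o \<Rightarrow> 'o \<Rightarrow> 'o \<Rightarrow> 'm \<Rightarrow> 'm) set"
  where "trace_families M =
    (\<Pi>\<^sub>E X \<in> Obj M. \<Pi>\<^sub>E A \<in> Obj M. \<Pi>\<^sub>E B \<in> Obj M.
      hom M (A \<otimes>\<^bsub>M\<^esub> X) (B \<otimes>\<^bsub>M\<^esub> X) \<rightarrow>\<^sub>E hom M A B)"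

locale right_trace = monoidal_category M
  for M :: "('o, 'm, 'x) monoidal_data_scheme" (structure) +
  fixes Tr :: "'o \<Rightarrow> 'o \<Rightarrow> 'o \<Rightarrow> 'm \<Rightarrow> 'm"
  assumes family: "Tr \<in> trace_families M"
    and tightening: "\<lbrakk>X \<in> Obj M; g \<in> hom M A' A; f \<in> hom M (A \<otimes> X) (B \<otimes> X); h \<in> hom M B B'\<rbrakk>
      \<Longrightarrow> Tr X A' B' ((h \<odot> \<one> X) \<cdot> f \<cdot> (g \<odot> \<one> X)) = h \<cdot> Tr X A B f \<cdot> g"
    and sliding: "\<lbrakk>A \<in> Obj M; B \<in> Obj M; f \<in> hom M (A \<otimes> X) (B \<otimes> Y); h \<in> hom M Y X\<rbrakk>
      \<Longrightarrow> Tr X A B ((\<one> B \<odot> h) \<cdot> f) = Tr Y A B (f \<cdot> (\<one> A \<odot> h))"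
    and vanishing_Unit: "\<lbrakk>A \<in> Obj M; B \<in> Obj M; f \<in> hom M (A \<otimes> Unit M) (B \<otimes> Unit M)\<rbrakk>
      \<Longrightarrow> Tr (Unit M) A B f = RUnit M B \<cdot> f \<cdot> inv (RUnit M A)"
    and vanishing_TenO: "\<lbrakk>A \<in> Obj M; B \<in> Obj M; X \<in> Obj M; Y \<in> Obj M;
        f \<in> hom M (A \<otimes> (X \<otimes> Y)) (B \<otimes> (X \<otimes> Y))\<rbrakk>
      \<Longrightarrow> Tr (X \<otimes> Y) A B f =
          Tr X A B (Tr Y (A \<otimes> X) (B \<otimes> X) (inv (Assoc M B X Y) \<cdot> f \<cdot> Assoc M A X Y))"
    and superposing: "\<lbrakk>A \<in> Obj M; B \<in> Obj M; X \<in> Obj M;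
        g \<in> hom M C D; f \<in> hom M (A \<otimes> X) (B \<otimes> X)\<rbrakk>
      \<Longrightarrow> Tr X (C \<otimes> A) (D \<otimes> B) (inv (Assoc M D B X) \<cdot> (g \<odot> f) \<cdot> Assoc M C A X) =
          g \<odot> Tr X A B f"

definition right_traces ::
    "('o, 'm, 'x) monoidal_data_scheme \<Rightarrow> ('o \<Rightarrow> 'o \<Rightarrow> 'o \<Rightarrow> 'm \<Rightarrow> 'm) set"
  where "right_traces M = {Tr. right_trace M Tr}"

text \<open>For the reversed product, \<open>Tr X A B\<close> is a map from \<open>hom M (X \<otimes> A) (X \<otimes> B)\<close> to
  \<open>hom M A B\<close>.\<close>

definition left_traces ::
    "('o, 'm, 'x) monoidal_data_scheme \<Rightarrow> ('o \<Rightarrow> 'o \<Rightarrow> 'o \<Rightarrow> 'm \<Rightarrow> 'm) set"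
  where "left_traces M = right_traces (rev_monoidal M)"

text \<open>\<open>RDual A\<close> and \<open>LDual A\<close> are the objects usually written with the \<open>\<bottom>\<close> to the right, respectively
  to the left, of \<open>A\<close>; \<open>RCur A X\<close> and \<open>LCur A X\<close> are the bijections from maps \<open>X \<rightarrow> RDual A\<close> to maps
  \<open>A \<otimes> X \<rightarrow> \<bottom>\<close>, and from maps \<open>X \<rightarrow> LDual A\<close> to maps \<open>X \<otimes> A \<rightarrow> \<bottom>\<close>.\<close>

record ('o, 'm) star_autonomous_data = "('o, 'm) monoidal_data" +
  Bot :: "'o"
  RDual :: "'o \<Rightarrow> 'o"
  LDual :: "'o \<Rightarrow> 'o"
  RCur :: "'o \<Rightarrow> 'o \<Rightarrow> 'm \<Rightarrow> 'm"
  LCur :: "'o \<Rightarrow> 'o \<Rightarrow> 'm \<Rightarrow> 'm"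

definition REval :: "('o, 'm, 'x) star_autonomous_data_scheme \<Rightarrow> 'o \<Rightarrow> 'm"
  where "REval C A = RCur C A (RDual C A) (\<one>\<^bsub>C\<^esub> (RDual C A))"

definition LEval :: "('o, 'm, 'x) star_autonomous_data_scheme \<Rightarrow> 'o \<Rightarrow> 'm"
  where "LEval C A = LCur C A (LDual C A) (\<one>\<^bsub>C\<^esub> (LDual C A))"

definition RUncur :: "('o, 'm, 'x) star_autonomous_data_scheme \<Rightarrow> 'o \<Rightarrow> 'o \<Rightarrow> 'm \<Rightarrow> 'm"
  where "RUncur C A X = the_inv_into (hom C X (RDual C A)) (RCur C A X)"

definition LUncur :: "('o, 'm, 'x) star_autonomous_data_scheme \<Rightarrow> 'o \<Rightarrow> 'o \<Rightarrow> 'm \<Rightarrow> 'm"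
  where "LUncur C A X = the_inv_into (hom C X (LDual C A)) (LCur C A X)"

text \<open>The canonical maps \<open>A \<rightarrow> LDual (RDual A)\<close> and \<open>A \<rightarrow> RDual (LDual A)\<close>.\<close>

definition LRunit :: "('o, 'm, 'x) star_autonomous_data_scheme \<Rightarrow> 'o \<Rightarrow> 'm"
  where "LRunit C A = LUncur C (RDual C A) A (REval C A)"

definition RLunit :: "('o, 'm, 'x) star_autonomous_data_scheme \<Rightarrow> 'o \<Rightarrow> 'm"
  where "RLunit C A = RUncur C (LDual C A) A (LEval C A)"

locale star_autonomous_category = monoidal_category C
  for C :: "('o, 'm, 'x) star_autonomous_data_scheme" (structure) +
  assumes Bot_Obj: "Bot C \<in> Obj C"
    and RDual_Obj: "A \<in> Obj C \<Longrightarrow> RDual C A \<in> Obj C"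
    and LDual_Obj: "A \<in> Obj C \<Longrightarrow> LDual C A \<in> Obj C"
    and RCur_bij: "\<lbrakk>A \<in> Obj C; X \<in> Obj C\<rbrakk>
      \<Longrightarrow> bij_betw (RCur C A X) (hom C X (RDual C A)) (hom C (A \<otimes> X) (Bot C))"
    and RCur_nat: "\<lbrakk>A \<in> Obj C; g \<in> hom C Y X; f \<in> hom C X (RDual C A)\<rbrakk>
      \<Longrightarrow> RCur C A Y (f \<cdot> g) = RCur C A X f \<cdot> (\<one> A \<odot> g)"
    and LCur_bij: "\<lbrakk>A \<in> Obj C; X \<in> Obj C\<rbrakk>
      \<Longrightarrow> bij_betw (LCur C A X) (hom C X (LDual C A)) (hom C (X \<otimes> A) (Bot C))"
    and LCur_nat: "\<lbrakk>A \<in> Obj C; g \<in> hom C Y X; f \<in> hom C X (LDual C A)\<rbrakk>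
      \<Longrightarrow> LCur C A Y (f \<cdot> g) = LCur C A X f \<cdot> (g \<odot> \<one> A)"
    and LRunit_iso: "A \<in> Obj C \<Longrightarrow> iso C (LRunit C A)"
    and RLunit_iso: "A \<in> Obj C \<Longrightarrow> iso C (RLunit C A)"

text \<open>\<open>RDualA f\<close> and \<open>LDualA f\<close> are the unique maps making the two duals contravariant functors for which
  the bijections are natural in \<open>A\<close> as well.\<close>

definition RDualA :: "('o, 'm, 'x) star_autonomous_data_scheme \<Rightarrow> 'm \<Rightarrow> 'm"
  where "RDualA C f = RUncur C (Dom C f) (RDual C (Cod C f))
    (REval C (Cod C f) \<cdot>\<^bsub>C\<^esub> (f \<odot>\<^bsub>C\<^esub> \<one>\<^bsub>C\<^esub> (RDual C (Cod C f))))"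

definition LDualA :: "('o, 'm, 'x) star_autonomous_data_scheme \<Rightarrow> 'm \<Rightarrow> 'm"
  where "LDualA C f = LUncur C (Dom C f) (LDual C (Cod C f))
    (LEval C (Cod C f) \<cdot>\<^bsub>C\<^esub> (\<one>\<^bsub>C\<^esub> (LDual C (Cod C f)) \<odot>\<^bsub>C\<^esub> f))"

text \<open>The map \<open>I \<rightarrow> RDual \<bottom>\<close> corresponding to \<open>\<bottom> \<otimes> I \<rightarrow> \<bottom>\<close>; it is an isomorphism.\<close>

definition unit_to_RDual_Bot :: "('o, 'm, 'x) star_autonomous_data_scheme \<Rightarrow> 'm"
  where "unit_to_RDual_Bot C = RUncur C (Bot C) (Unit C) (RUnit C (Bot C))"

text \<open>The structure maps below are those of \<open>\<otimes>\<close>, transported along the duality: \<open>RDual\<close> turns the dual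
  tensor product of \<open>A\<close> and \<open>B\<close> into \<open>RDual B \<otimes> RDual A\<close>, up to the isomorphism
  \<open>RLunit (RDual B \<otimes> RDual A)\<close>.\<close>

definition par :: "('o, 'm, 'x) star_autonomous_data_scheme \<Rightarrow> ('o, 'm) monoidal_data"
  where "par C =
   \<lparr>Obj = Obj C, Arr = Arr C, Dom = Dom C, Cod = Cod C, Idn = Idn C, Comp = Comp C,
    TenO = (\<lambda>A B. LDual C (RDual C B \<otimes>\<^bsub>C\<^esub> RDual C A)),
    TenA = (\<lambda>f g. LDualA C (RDualA C g \<odot>\<^bsub>C\<^esub> RDualA C f)),
    Unit = Bot C,
    Assoc = (\<lambda>A B D. LDualA C
      ((\<one>\<^bsub>C\<^esub> (RDual C D) \<odot>\<^bsub>C\<^esub> RLunit C (RDual C B \<otimes>\<^bsub>C\<^esub> RDual C A)) \<cdot>\<^bsub>C\<^esub>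
       Assoc C (RDual C D) (RDual C B) (RDual C A) \<cdot>\<^bsub>C\<^esub>
       (inv\<^bsub>C\<^esub> (RLunit C (RDual C D \<otimes>\<^bsub>C\<^esub> RDual C B)) \<odot>\<^bsub>C\<^esub> \<one>\<^bsub>C\<^esub> (RDual C A)))),
    LUnit = (\<lambda>A. inv\<^bsub>C\<^esub> (LRunit C A) \<cdot>\<^bsub>C\<^esub>
      LDualA C ((\<one>\<^bsub>C\<^esub> (RDual C A) \<odot>\<^bsub>C\<^esub> unit_to_RDual_Bot C) \<cdot>\<^bsub>C\<^esub>
        inv\<^bsub>C\<^esub> (RUnit C (RDual C A)))),
    RUnit = (\<lambda>A. inv\<^bsub>C\<^esub> (LRunit C A) \<cdot>\<^bsub>C\<^esub>
      LDualA C ((unit_to_RDual_Bot C \<odot>\<^bsub>C\<^esub> \<one>\<^bsub>C\<^esub> (RDual C A)) \<cdot>\<^bsub>C\<^esub>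
        inv\<^bsub>C\<^esub> (LUnit C (RDual C A))))\<rparr>"

text \<open>For \<open>f\<close> from the dual tensor product of \<open>X\<close> and \<open>A\<close> to that of \<open>X\<close> and \<open>B\<close>, \<open>RDualA f\<close>
  becomes, up to \<open>RLunit\<close>, a map \<open>RDual B \<otimes> RDual X \<rightarrow> RDual A \<otimes> RDual X\<close>; its trace
  \<open>RDual B \<rightarrow> RDual A\<close> corresponds under \<open>LDual\<close> and \<open>LRunit\<close> to a map \<open>A \<rightarrow> B\<close>.\<close>

definition left_of_right_trace :: "('o, 'm, 'x) star_autonomous_data_scheme
    \<Rightarrow> ('o \<Rightarrow> 'o \<Rightarrow> 'o \<Rightarrow> 'm \<Rightarrow> 'm) \<Rightarrow> ('o \<Rightarrow> 'o \<Rightarrow> 'o \<Rightarrow> 'm \<Rightarrow> 'm)"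
  where "left_of_right_trace C Tr =
    (\<lambda>X \<in> Obj C. \<lambda>A \<in> Obj C. \<lambda>B \<in> Obj C.
      \<lambda>f \<in> hom C (X \<otimes>\<^bsub>par C\<^esub> A) (X \<otimes>\<^bsub>par C\<^esub> B).
        inv\<^bsub>C\<^esub> (LRunit C B) \<cdot>\<^bsub>C\<^esub>
        LDualA C (Tr (RDual C X) (RDual C B) (RDual C A)
          (inv\<^bsub>C\<^esub> (RLunit C (RDual C A \<otimes>\<^bsub>C\<^esub> RDual C X)) \<cdot>\<^bsub>C\<^esub>
           RDualA C f \<cdot>\<^bsub>C\<^esub>
           RLunit C (RDual C B \<otimes>\<^bsub>C\<^esub> RDual C X))) \<cdot>\<^bsub>C\<^esub>
        LRunit C A)"

text \<open>Conversely, for \<open>f : A \<otimes> X \<rightarrow> B \<otimes> X\<close>, the map \<open>LDualA f\<close> is traced along \<open>LDual X\<close>, where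
  \<open>LDual (A \<otimes> X)\<close> is identified with the dual tensor product of \<open>LDual X\<close> and \<open>LDual A\<close>, which is
  \<open>LDual (RDual (LDual A) \<otimes> RDual (LDual X))\<close>, by means of \<open>LDualA (RLunit A \<odot> RLunit X)\<close>.\<close>

definition right_of_left_trace :: "('o, 'm, 'x) star_autonomous_data_scheme
    \<Rightarrow> ('o \<Rightarrow> 'o \<Rightarrow> 'o \<Rightarrow> 'm \<Rightarrow> 'm) \<Rightarrow> ('o \<Rightarrow> 'o \<Rightarrow> 'o \<Rightarrow> 'm \<Rightarrow> 'm)"
  where "right_of_left_trace C T =
    (\<lambda>X \<in> Obj C. \<lambda>A \<in> Obj C. \<lambda>B \<in> Obj C.
      \<lambda>f \<in> hom C (A \<otimes>\<^bsub>C\<^esub> X) (B \<otimes>\<^bsub>C\<^esub> X).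
        inv\<^bsub>C\<^esub> (RLunit C B) \<cdot>\<^bsub>C\<^esub>
        RDualA C (T (LDual C X) (LDual C B) (LDual C A)
          (inv\<^bsub>C\<^esub> (LDualA C (RLunit C A \<odot>\<^bsub>C\<^esub> RLunit C X)) \<cdot>\<^bsub>C\<^esub>
           LDualA C f \<cdot>\<^bsub>C\<^esub>
           LDualA C (RLunit C B \<odot>\<^bsub>C\<^esub> RLunit C X))) \<cdot>\<^bsub>C\<^esub>
        RLunit C A)"

end

theory Submission
  imports Defs
begin

text \<open>
  A right trace is a self-dual notion: read in the opposite category, each axiom becomes an axiom again,
  sliding being exchanged with itself and the two sides of the other equations merely reversed. The dual
  tensor product is, by construction, the structure that makes the duality a contravariant monoidal
  equivalence. Written for the reversed product \<open>A \<boxdot> B = LDual (RDual A \<otimes> RDual B)\<close>, whose right traces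
  are the left traces of the dual tensor product, the equivalence does not even change the order of the
  factors. So the theorem says that traces can be transported along a contravariant monoidal equivalence.

  The transport is carried out for a fully faithful contravariant functor \<open>F\<close> from \<open>M\<close> to \<open>N\<close> with
  isomorphisms \<open>\<phi> : F A \<otimes> F B \<rightarrow> F (A \<otimes> B)\<close> and \<open>\<phi>\<^sub>0 : I \<rightarrow> F I\<close> satisfying the usual coherence conditions.
  A trace \<open>Tr\<close> on \<open>N\<close> is pulled back to the unique \<open>T\<close> with
  \<open>F (T f) = Tr (\<phi>\<inverse> \<cdot> F f \<cdot> \<phi>)\<close>. Since \<open>F\<close> is faithful, the trace axioms for \<open>T\<close> can be checked after
  applying \<open>F\<close>, where they follow from those for \<open>Tr\<close> and the coherence of \<open>\<phi>\<close>
  (\<open>right_trace_pulled_back\<close>). By the same principle the monoidal axioms for \<open>M\<close> follow from those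
  for \<open>N\<close> (\<open>M_monoidal\<close>); this gives the pentagon and the triangle for the dual tensor product.

  Both \<open>RDual\<close>, from the dual tensor product to \<open>\<otimes>\<close>, and \<open>LDual\<close>, from \<open>\<otimes>\<close> to the dual tensor product, are
  functors of this kind (\<open>RDual_monoidal_embedding\<close>, \<open>LDual_monoidal_embedding\<close>), and the two assignments of
  the theorem are the two pullbacks. Both have the same shape, so one lemma serves for either direction.
  The canonical isomorphisms \<open>RLunit : A \<rightarrow> RDual (LDual A)\<close> and \<open>LRunit : A \<rightarrow> LDual (RDual A)\<close> are
  monoidal. Pulling back twice therefore amounts to conjugating by a monoidal natural isomorphism, and
  tightening and sliding show that a trace is invariant under that (\<open>pulled_back_trace_inverse\<close>).
\<close>

section \<open>Calculating with arrows\<close>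

text \<open>
  Membership in a hom-set is always split into conditions on \<open>Arr\<close>, \<open>Dom\<close> and \<open>Cod\<close>: these can be computed
  from the shape of an arrow, so the simplifier can discharge them, whereas the intermediate objects in a
  typing by hom-sets would have to be guessed. Composites are normalised to the right and adjacent tensor
  products of arrows are merged.
\<close>

lemma in_hom [simp]: "f \<in> hom C A B \<longleftrightarrow> f \<in> Arr C \<and> Dom C f = A \<and> Cod C f = B"
  by (simp add: hom_def)

context category
begin

lemma Idn_arr [simp]:
  assumes "A \<in> Obj C"
  shows "\<one> A \<in> Arr C" "Dom C (\<one> A) = A" "Cod C (\<one> A) = A"
  using Idn_hom [OF assms] by auto

lemma Comp_arr [simp]:
  assumes "f \<in> Arr C" "g \<in> Arr C" "Dom C g = Cod C f"
  shows "g \<cdot> f \<in> Arr C" "Dom C (g \<cdot> f) = Dom C f" "Cod C (g \<cdot> f) = Cod C g"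
  using Comp_hom [of f "Dom C f" "Cod C f" g "Cod C g"] assms by auto

lemma Dom_Cod_Obj [simp]:
  assumes "f \<in> Arr C"
  shows "Dom C f \<in> Obj C" "Cod C f \<in> Obj C"
  using assms Dom_Obj Cod_Obj by auto

lemma Comp_Idn_arr [simp]: "f \<in> Arr C \<Longrightarrow> Dom C f = A \<Longrightarrow> f \<cdot> \<one> A = f"
  using Comp_Idn [of f A "Cod C f"] by simp

lemma Idn_Comp_arr [simp]: "f \<in> Arr C \<Longrightarrow> Cod C f = A \<Longrightarrow> \<one> A \<cdot> f = f"
  using Idn_Comp [of f "Dom C f" A] by simp

lemma Comp_assoc_arr [simp]:
  "\<lbrakk>f \<in> Arr C; g \<in> Arr C; h \<in> Arr C; Dom C g = Cod C f; Dom C h = Cod C g\<rbrakk>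
    \<Longrightarrow> (h \<cdot> g) \<cdot> f = h \<cdot> (g \<cdot> f)"
  using Comp_assoc [of f "Dom C f" "Cod C f" g "Cod C g" h "Cod C h"] by simp

text \<open>This applies an equation between composites inside a longer composite that is associated to the right.\<close>

lemma Comp_extend:
  assumes "g \<cdot> f = k" "f \<in> Arr C" "g \<in> Arr C" "Dom C g = Cod C f" "x \<in> Arr C" "Cod C x = Dom C f"
  shows "g \<cdot> (f \<cdot> x) = k \<cdot> x"
  using assms by (metis Comp_assoc_arr)

lemma inverse_arrows_unique: "inverse_arrows C f g \<Longrightarrow> inverse_arrows C f h \<Longrightarrow> g = h"
  unfolding inverse_arrows_def
  by (metis Comp_Idn_arr Comp_assoc_arr Idn_Comp_arr in_hom)

lemma inv_eqI:
  assumes "inverse_arrows C f g" shows "inv f = g" "iso C f"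
  using assms inverse_arrows_unique unfolding arr_inv_def iso_def by blast+

lemma iso_inverse_arrows: "iso C f \<Longrightarrow> inverse_arrows C f (inv f)"
  using inv_eqI unfolding iso_def by fastforce

lemma iso_Arr [simp]: "iso C f \<Longrightarrow> f \<in> Arr C"
  by (auto simp: iso_def inverse_arrows_def)

lemma inv_arr [simp]:
  assumes "iso C f"
  shows "inv f \<in> Arr C" "Dom C (inv f) = Cod C f" "Cod C (inv f) = Dom C f"
    "inv f \<cdot> f = \<one> (Dom C f)" "f \<cdot> inv f = \<one> (Cod C f)"
  using iso_inverse_arrows [OF assms] by (auto simp: inverse_arrows_def)

lemma inv_Comp_cancel [simp]:
  assumes "iso C f" "x \<in> Arr C"
  shows "Cod C x = Dom C f \<Longrightarrow> inv f \<cdot> (f \<cdot> x) = x" "Cod C x = Cod C f \<Longrightarrow> f \<cdot> (inv f \<cdot> x) = x"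
  using assms Comp_extend by (metis Idn_Comp_arr inv_arr iso_Arr)+

lemma iso_Idn [simp]: "A \<in> Obj C \<Longrightarrow> iso C (\<one> A)" "A \<in> Obj C \<Longrightarrow> inv (\<one> A) = \<one> A"
  by (rule inv_eqI [of "\<one> A" "\<one> A"]; simp add: inverse_arrows_def)+

lemma iso_inv [simp]: "iso C f \<Longrightarrow> iso C (inv f)" "iso C f \<Longrightarrow> inv (inv f) = f"
  by (rule inv_eqI [of "inv f" f]; simp add: inverse_arrows_def)+

lemma iso_Comp [simp]:
  assumes "iso C f" "iso C g" "Dom C g = Cod C f"
  shows "iso C (g \<cdot> f)" "inv (g \<cdot> f) = inv f \<cdot> inv g"
  by (rule inv_eqI [of "g \<cdot> f" "inv f \<cdot> inv g"]; use assms in \<open>simp add: inverse_arrows_def\<close>)+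

lemma iso_cancel_right:
  assumes "iso C k" "f \<in> Arr C" "g \<in> Arr C" "Dom C f = Cod C k" "Dom C g = Cod C k" "f \<cdot> k = g \<cdot> k"
  shows "f = g"
proof -
  have "(f \<cdot> k) \<cdot> inv k = (g \<cdot> k) \<cdot> inv k" by (simp add: assms(6))
  then show ?thesis using assms(1-5) by simp
qed

lemma iso_cancel_left:
  assumes "iso C k" "f \<in> Arr C" "g \<in> Arr C" "Cod C f = Dom C k" "Cod C g = Dom C k" "k \<cdot> f = k \<cdot> g"
  shows "f = g"
proof -
  have "inv k \<cdot> (k \<cdot> f) = inv k \<cdot> (k \<cdot> g)" by (simp add: assms(6))
  then show ?thesis using assms(1-5) by simp
qed

lemma inv_square:
  assumes "iso C k" "iso C k'" "f \<in> Arr C" "g \<in> Arr C" "Dom C f = Cod C k" "Cod C f = Cod C k'"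
    "Dom C g = Dom C k" "Cod C g = Dom C k'" "f \<cdot> k = k' \<cdot> g"
  shows "inv k' \<cdot> f = g \<cdot> inv k"
proof (rule iso_cancel_right [of k])
  show "(inv k' \<cdot> f) \<cdot> k = (g \<cdot> inv k) \<cdot> k" using assms by simp
qed (use assms in simp_all)

end

context monoidal_category
begin

lemma TenO_Obj_simp [simp]: "A \<in> Obj C \<Longrightarrow> B \<in> Obj C \<Longrightarrow> A \<otimes> B \<in> Obj C"
  by (rule TenO_Obj)

lemma TenA_arr [simp]:
  assumes "f \<in> Arr C" "g \<in> Arr C"
  shows "f \<odot> g \<in> Arr C" "Dom C (f \<odot> g) = Dom C f \<otimes> Dom C g" "Cod C (f \<odot> g) = Cod C f \<otimes> Cod C g"
  using TenA_hom [of f "Dom C f" "Cod C f" g "Dom C g" "Cod C g"] assms by auto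

declare TenA_Idn [simp] Unit_Obj [simp] Assoc_iso [simp] LUnit_iso [simp] RUnit_iso [simp]

lemma interchange [simp]:
  assumes "f \<in> Arr C" "g \<in> Arr C" "f' \<in> Arr C" "g' \<in> Arr C" "Dom C g = Cod C f" "Dom C g' = Cod C f'"
  shows "(g \<odot> g') \<cdot> (f \<odot> f') = (g \<cdot> f) \<odot> (g' \<cdot> f')"
    "x \<in> Arr C \<Longrightarrow> Cod C x = Dom C f \<otimes> Dom C f' \<Longrightarrow>
      (g \<odot> g') \<cdot> ((f \<odot> f') \<cdot> x) = ((g \<cdot> f) \<odot> (g' \<cdot> f')) \<cdot> x"
proof -
  show *: "(g \<odot> g') \<cdot> (f \<odot> f') = (g \<cdot> f) \<odot> (g' \<cdot> f')"
    using TenA_Comp [of f "Dom C f" "Cod C f" g "Cod C g" f' "Dom C f'" "Cod C f'" g' "Cod C g'"] assms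
    by simp
  show "x \<in> Arr C \<Longrightarrow> Cod C x = Dom C f \<otimes> Dom C f' \<Longrightarrow>
      (g \<odot> g') \<cdot> ((f \<odot> f') \<cdot> x) = ((g \<cdot> f) \<odot> (g' \<cdot> f')) \<cdot> x"
    using assms by (intro Comp_extend *) simp_all
qed

lemma structure_arr [simp]:
  "\<lbrakk>A \<in> Obj C; B \<in> Obj C; D \<in> Obj C\<rbrakk> \<Longrightarrow> Dom C (Assoc C A B D) = (A \<otimes> B) \<otimes> D"
  "\<lbrakk>A \<in> Obj C; B \<in> Obj C; D \<in> Obj C\<rbrakk> \<Longrightarrow> Cod C (Assoc C A B D) = A \<otimes> (B \<otimes> D)"
  "A \<in> Obj C \<Longrightarrow> Dom C (LUnit C A) = Unit C \<otimes> A"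
  "A \<in> Obj C \<Longrightarrow> Cod C (LUnit C A) = A"
  "A \<in> Obj C \<Longrightarrow> Dom C (RUnit C A) = A \<otimes> Unit C"
  "A \<in> Obj C \<Longrightarrow> Cod C (RUnit C A) = A"
  using Assoc_hom LUnit_hom RUnit_hom by auto

lemma iso_TenA [simp]:
  assumes "iso C f" "iso C g"
  shows "iso C (f \<odot> g)" "inv (f \<odot> g) = inv f \<odot> inv g"
  by (rule inv_eqI [of "f \<odot> g" "inv f \<odot> inv g"]; use assms in \<open>simp add: inverse_arrows_def\<close>)+

lemma Assoc_nat_arr:
  assumes "f \<in> Arr C" "g \<in> Arr C" "h \<in> Arr C"
  shows "(f \<odot> (g \<odot> h)) \<cdot> Assoc C (Dom C f) (Dom C g) (Dom C h) =
    Assoc C (Cod C f) (Cod C g) (Cod C h) \<cdot> ((f \<odot> g) \<odot> h)"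
  using Assoc_nat [of f "Dom C f" "Cod C f" g "Dom C g" "Cod C g" h "Dom C h" "Cod C h"] assms by simp

end

section \<open>Contravariant monoidal embeddings\<close>

text \<open>
  Full faithfulness is part of the notion: equations and isomorphisms in \<open>M\<close> are recognised by their images
  in \<open>N\<close>.
\<close>

locale contravariant_embedding = M: category M + N: category N
  for M :: "('o, 'm, 'x) category_data_scheme" and N :: "('p, 'n, 'y) category_data_scheme" +
  fixes Fo :: "'o \<Rightarrow> 'p" and Fa :: "'m \<Rightarrow> 'n"
  assumes Fo_Obj [simp]: "A \<in> Obj M \<Longrightarrow> Fo A \<in> Obj N"
    and Fa_Idn [simp]: "A \<in> Obj M \<Longrightarrow> Fa (\<one>\<^bsub>M\<^esub> A) = \<one>\<^bsub>N\<^esub> (Fo A)"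
    and Fa_Comp: "\<lbrakk>f \<in> hom M A B; g \<in> hom M B D\<rbrakk> \<Longrightarrow> Fa (g \<cdot>\<^bsub>M\<^esub> f) = Fa f \<cdot>\<^bsub>N\<^esub> Fa g"
    and Fa_bij: "\<lbrakk>A \<in> Obj M; B \<in> Obj M\<rbrakk> \<Longrightarrow> bij_betw Fa (hom M A B) (hom N (Fo B) (Fo A))"
begin

lemma Fa_arr [simp]:
  assumes "f \<in> Arr M"
  shows "Fa f \<in> Arr N" "Dom N (Fa f) = Fo (Cod M f)" "Cod N (Fa f) = Fo (Dom M f)"
proof -
  have "Fa f \<in> hom N (Fo (Cod M f)) (Fo (Dom M f))"
    using assms by (intro bij_betw_apply [OF Fa_bij]) simp_all
  then show "Fa f \<in> Arr N" "Dom N (Fa f) = Fo (Cod M f)" "Cod N (Fa f) = Fo (Dom M f)" by simp_all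
qed

lemma Fa_Comp_arr [simp]:
  "\<lbrakk>f \<in> Arr M; g \<in> Arr M; Dom M g = Cod M f\<rbrakk> \<Longrightarrow> Fa (g \<cdot>\<^bsub>M\<^esub> f) = Fa f \<cdot>\<^bsub>N\<^esub> Fa g"
  by (rule Fa_Comp [of f "Dom M f" "Cod M f" g "Cod M g"]) simp_all

lemma Fa_inject:
  assumes "f \<in> Arr M" "g \<in> Arr M" "Dom M g = Dom M f" "Cod M g = Cod M f" "Fa f = Fa g"
  shows "f = g"
  using Fa_bij [of "Dom M f" "Cod M f"] assms unfolding bij_betw_def inj_on_def by simp

lemma Fa_inject_iso:
  assumes "iso N k" "f \<in> Arr M" "g \<in> Arr M" "Dom M g = Dom M f" "Cod M g = Cod M f"
    "Cod N k = Fo (Cod M f)" "Fa f \<cdot>\<^bsub>N\<^esub> k = Fa g \<cdot>\<^bsub>N\<^esub> k"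
  shows "f = g"
proof (rule Fa_inject)
  show "Fa f = Fa g" by (rule N.iso_cancel_right [of k]) (use assms in simp_all)
qed (use assms in simp_all)

lemma Fa_surj:
  assumes "h \<in> Arr N" "Dom N h = Fo B" "Cod N h = Fo A" "A \<in> Obj M" "B \<in> Obj M"
  obtains f where "f \<in> Arr M" "Dom M f = A" "Cod M f = B" "Fa f = h"
proof -
  have "h \<in> Fa ` hom M A B"
    using Fa_bij [of A B] assms unfolding bij_betw_def by simp
  then show thesis using that by auto
qed

lemma Fa_iso [simp]:
  assumes "iso M f"
  shows "iso N (Fa f)" "Fa (inv\<^bsub>M\<^esub> f) = inv\<^bsub>N\<^esub> (Fa f)"
proof -
  have "inverse_arrows N (Fa f) (Fa (inv\<^bsub>M\<^esub> f))"
    unfolding inverse_arrows_def using assms by (simp flip: Fa_Comp_arr)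
  then show "iso N (Fa f)" "Fa (inv\<^bsub>M\<^esub> f) = inv\<^bsub>N\<^esub> (Fa f)"
    using N.inv_eqI by auto
qed

lemma Fa_reflects_iso:
  assumes "f \<in> Arr M" "iso N (Fa f)"
  shows "iso M f"
proof -
  obtain g where g: "g \<in> Arr M" "Dom M g = Cod M f" "Cod M g = Dom M f" "Fa g = inv\<^bsub>N\<^esub> (Fa f)"
    by (rule Fa_surj [of "inv\<^bsub>N\<^esub> (Fa f)" "Dom M f" "Cod M f"]) (use assms in simp_all)
  have "inverse_arrows M f g"
    unfolding inverse_arrows_def using assms g by (auto intro!: Fa_inject)
  then show ?thesis by (rule M.inv_eqI)
qed

end

text \<open>
  The tensor product of \<open>M\<close> is given by typed data only, while \<open>N\<close> is a monoidal category. The axioms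
  of a monoidal category for \<open>M\<close> are consequences, since the embedding reflects them. The isomorphisms \<open>phi\<close> point to the
  image of the tensor product, so that \<open>RDual\<close> and \<open>LDual\<close>, with the isomorphisms occurring in the two
  transports of traces, both fit.
\<close>

locale contravariant_monoidal_embedding =
  contravariant_embedding M N Fo Fa + N: monoidal_category N
  for M :: "('o, 'm, 'x) monoidal_data_scheme" and N :: "('p, 'n, 'y) monoidal_data_scheme"
    and Fo :: "'o \<Rightarrow> 'p" and Fa :: "'m \<Rightarrow> 'n" +
  fixes phi :: "'o \<Rightarrow> 'o \<Rightarrow> 'n" and phi0 :: 'n
  assumes M_TenO: "\<lbrakk>A \<in> Obj M; B \<in> Obj M\<rbrakk> \<Longrightarrow> A \<otimes>\<^bsub>M\<^esub> B \<in> Obj M"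
    and M_TenA: "\<lbrakk>f \<in> hom M A B; g \<in> hom M A' B'\<rbrakk>
      \<Longrightarrow> f \<odot>\<^bsub>M\<^esub> g \<in> hom M (A \<otimes>\<^bsub>M\<^esub> A') (B \<otimes>\<^bsub>M\<^esub> B')"
    and M_Unit: "Unit M \<in> Obj M"
    and M_Assoc: "\<lbrakk>A \<in> Obj M; B \<in> Obj M; D \<in> Obj M\<rbrakk>
      \<Longrightarrow> Assoc M A B D \<in> hom M ((A \<otimes>\<^bsub>M\<^esub> B) \<otimes>\<^bsub>M\<^esub> D) (A \<otimes>\<^bsub>M\<^esub> (B \<otimes>\<^bsub>M\<^esub> D))"
    and M_LUnit: "A \<in> Obj M \<Longrightarrow> LUnit M A \<in> hom M (Unit M \<otimes>\<^bsub>M\<^esub> A) A"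
    and M_RUnit: "A \<in> Obj M \<Longrightarrow> RUnit M A \<in> hom M (A \<otimes>\<^bsub>M\<^esub> Unit M) A"
    and phi_hom: "\<lbrakk>A \<in> Obj M; B \<in> Obj M\<rbrakk> \<Longrightarrow> phi A B \<in> hom N (Fo A \<otimes>\<^bsub>N\<^esub> Fo B) (Fo (A \<otimes>\<^bsub>M\<^esub> B))"
    and phi_iso [simp]: "\<lbrakk>A \<in> Obj M; B \<in> Obj M\<rbrakk> \<Longrightarrow> iso N (phi A B)"
    and phi_nat: "\<lbrakk>f \<in> hom M A A'; g \<in> hom M B B'\<rbrakk>
      \<Longrightarrow> Fa (f \<odot>\<^bsub>M\<^esub> g) \<cdot>\<^bsub>N\<^esub> phi A' B' = phi A B \<cdot>\<^bsub>N\<^esub> (Fa f \<odot>\<^bsub>N\<^esub> Fa g)"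
    and phi0_hom: "phi0 \<in> hom N (Unit N) (Fo (Unit M))"
    and phi0_iso [simp]: "iso N phi0"
    and phi_Assoc: "\<lbrakk>A \<in> Obj M; B \<in> Obj M; D \<in> Obj M\<rbrakk>
      \<Longrightarrow> Fa (Assoc M A B D) \<cdot>\<^bsub>N\<^esub> phi A (B \<otimes>\<^bsub>M\<^esub> D) \<cdot>\<^bsub>N\<^esub> (\<one>\<^bsub>N\<^esub> (Fo A) \<odot>\<^bsub>N\<^esub> phi B D) \<cdot>\<^bsub>N\<^esub>
            Assoc N (Fo A) (Fo B) (Fo D) =
          phi (A \<otimes>\<^bsub>M\<^esub> B) D \<cdot>\<^bsub>N\<^esub> (phi A B \<odot>\<^bsub>N\<^esub> \<one>\<^bsub>N\<^esub> (Fo D))"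
    and phi_LUnit: "A \<in> Obj M
      \<Longrightarrow> Fa (LUnit M A) \<cdot>\<^bsub>N\<^esub> LUnit N (Fo A) = phi (Unit M) A \<cdot>\<^bsub>N\<^esub> (phi0 \<odot>\<^bsub>N\<^esub> \<one>\<^bsub>N\<^esub> (Fo A))"
    and phi_RUnit: "A \<in> Obj M
      \<Longrightarrow> Fa (RUnit M A) \<cdot>\<^bsub>N\<^esub> RUnit N (Fo A) = phi A (Unit M) \<cdot>\<^bsub>N\<^esub> (\<one>\<^bsub>N\<^esub> (Fo A) \<odot>\<^bsub>N\<^esub> phi0)"
begin

lemma M_typing [simp]:
  "\<lbrakk>A \<in> Obj M; B \<in> Obj M\<rbrakk> \<Longrightarrow> A \<otimes>\<^bsub>M\<^esub> B \<in> Obj M"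
  "\<lbrakk>f \<in> Arr M; g \<in> Arr M\<rbrakk> \<Longrightarrow> f \<odot>\<^bsub>M\<^esub> g \<in> Arr M"
  "\<lbrakk>f \<in> Arr M; g \<in> Arr M\<rbrakk> \<Longrightarrow> Dom M (f \<odot>\<^bsub>M\<^esub> g) = Dom M f \<otimes>\<^bsub>M\<^esub> Dom M g"
  "\<lbrakk>f \<in> Arr M; g \<in> Arr M\<rbrakk> \<Longrightarrow> Cod M (f \<odot>\<^bsub>M\<^esub> g) = Cod M f \<otimes>\<^bsub>M\<^esub> Cod M g"
  "Unit M \<in> Obj M"
  "\<lbrakk>A \<in> Obj M; B \<in> Obj M; D \<in> Obj M\<rbrakk> \<Longrightarrow> Assoc M A B D \<in> Arr M"
  "\<lbrakk>A \<in> Obj M; B \<in> Obj M; D \<in> Obj M\<rbrakk> \<Longrightarrow> Dom M (Assoc M A B D) = (A \<otimes>\<^bsub>M\<^esub> B) \<otimes>\<^bsub>M\<^esub> D"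
  "\<lbrakk>A \<in> Obj M; B \<in> Obj M; D \<in> Obj M\<rbrakk> \<Longrightarrow> Cod M (Assoc M A B D) = A \<otimes>\<^bsub>M\<^esub> (B \<otimes>\<^bsub>M\<^esub> D)"
  "A \<in> Obj M \<Longrightarrow> LUnit M A \<in> Arr M"
  "A \<in> Obj M \<Longrightarrow> Dom M (LUnit M A) = Unit M \<otimes>\<^bsub>M\<^esub> A"
  "A \<in> Obj M \<Longrightarrow> Cod M (LUnit M A) = A"
  "A \<in> Obj M \<Longrightarrow> RUnit M A \<in> Arr M"
  "A \<in> Obj M \<Longrightarrow> Dom M (RUnit M A) = A \<otimes>\<^bsub>M\<^esub> Unit M"
  "A \<in> Obj M \<Longrightarrow> Cod M (RUnit M A) = A"
  using M_TenO M_Unit M_Assoc M_LUnit M_RUnit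
    M_TenA [of f "Dom M f" "Cod M f" g "Dom M g" "Cod M g"] by auto

lemma phi_arr [simp]:
  "\<lbrakk>A \<in> Obj M; B \<in> Obj M\<rbrakk> \<Longrightarrow> Dom N (phi A B) = Fo A \<otimes>\<^bsub>N\<^esub> Fo B"
  "\<lbrakk>A \<in> Obj M; B \<in> Obj M\<rbrakk> \<Longrightarrow> Cod N (phi A B) = Fo (A \<otimes>\<^bsub>M\<^esub> B)"
  "Dom N phi0 = Unit N" "Cod N phi0 = Fo (Unit M)"
  using phi_hom phi0_hom by auto

lemma phi_nat_arr:
  assumes "f \<in> Arr M" "g \<in> Arr M" "Cod M f = A" "Cod M g = B"
  shows "Fa (f \<odot>\<^bsub>M\<^esub> g) \<cdot>\<^bsub>N\<^esub> phi A B = phi (Dom M f) (Dom M g) \<cdot>\<^bsub>N\<^esub> (Fa f \<odot>\<^bsub>N\<^esub> Fa g)"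
    "x \<in> Arr N \<Longrightarrow> Cod N x = Fo A \<otimes>\<^bsub>N\<^esub> Fo B \<Longrightarrow>
      Fa (f \<odot>\<^bsub>M\<^esub> g) \<cdot>\<^bsub>N\<^esub> (phi A B \<cdot>\<^bsub>N\<^esub> x) =
      phi (Dom M f) (Dom M g) \<cdot>\<^bsub>N\<^esub> ((Fa f \<odot>\<^bsub>N\<^esub> Fa g) \<cdot>\<^bsub>N\<^esub> x)"
proof -
  show *: "Fa (f \<odot>\<^bsub>M\<^esub> g) \<cdot>\<^bsub>N\<^esub> phi A B = phi (Dom M f) (Dom M g) \<cdot>\<^bsub>N\<^esub> (Fa f \<odot>\<^bsub>N\<^esub> Fa g)"
    using phi_nat [of f "Dom M f" A g "Dom M g" B] assms by simp
  have AB: "A \<in> Obj M" "B \<in> Obj M" using assms by auto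
  show "x \<in> Arr N \<Longrightarrow> Cod N x = Fo A \<otimes>\<^bsub>N\<^esub> Fo B \<Longrightarrow>
      Fa (f \<odot>\<^bsub>M\<^esub> g) \<cdot>\<^bsub>N\<^esub> (phi A B \<cdot>\<^bsub>N\<^esub> x) =
      phi (Dom M f) (Dom M g) \<cdot>\<^bsub>N\<^esub> ((Fa f \<odot>\<^bsub>N\<^esub> Fa g) \<cdot>\<^bsub>N\<^esub> x)"
    using N.Comp_extend [OF *] assms AB by simp
qed

text \<open>Naturality of \<open>Assoc N\<close> absorbs arrows into the three arguments; this is the form of the
  coherence of \<open>phi\<close> with \<open>Assoc\<close> that composes with itself.\<close>

lemma phi_Assoc_arr:
  assumes "A \<in> Obj M" "B \<in> Obj M" "D \<in> Obj M"
    and "u \<in> Arr N" "v \<in> Arr N" "w \<in> Arr N" "Cod N u = Fo A" "Cod N v = Fo B" "Cod N w = Fo D"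
    and "a = Dom N u" "b = Dom N v" "d = Dom N w"
  shows "Fa (Assoc M A B D) \<cdot>\<^bsub>N\<^esub> phi A (B \<otimes>\<^bsub>M\<^esub> D) \<cdot>\<^bsub>N\<^esub>
      (u \<odot>\<^bsub>N\<^esub> (phi B D \<cdot>\<^bsub>N\<^esub> (v \<odot>\<^bsub>N\<^esub> w))) \<cdot>\<^bsub>N\<^esub> Assoc N a b d =
    phi (A \<otimes>\<^bsub>M\<^esub> B) D \<cdot>\<^bsub>N\<^esub> ((phi A B \<cdot>\<^bsub>N\<^esub> (u \<odot>\<^bsub>N\<^esub> v)) \<odot>\<^bsub>N\<^esub> w)" (is "?L = ?R")
proof -
  have split: "u \<odot>\<^bsub>N\<^esub> (phi B D \<cdot>\<^bsub>N\<^esub> (v \<odot>\<^bsub>N\<^esub> w)) =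
      (\<one>\<^bsub>N\<^esub> (Fo A) \<odot>\<^bsub>N\<^esub> phi B D) \<cdot>\<^bsub>N\<^esub> (u \<odot>\<^bsub>N\<^esub> (v \<odot>\<^bsub>N\<^esub> w))"
    using assms by simp
  have "?L = Fa (Assoc M A B D) \<cdot>\<^bsub>N\<^esub> phi A (B \<otimes>\<^bsub>M\<^esub> D) \<cdot>\<^bsub>N\<^esub> (\<one>\<^bsub>N\<^esub> (Fo A) \<odot>\<^bsub>N\<^esub> phi B D) \<cdot>\<^bsub>N\<^esub>
      ((u \<odot>\<^bsub>N\<^esub> (v \<odot>\<^bsub>N\<^esub> w)) \<cdot>\<^bsub>N\<^esub> Assoc N a b d)"
    unfolding split using assms by (simp del: N.interchange)
  also have "\<dots> = (Fa (Assoc M A B D) \<cdot>\<^bsub>N\<^esub> phi A (B \<otimes>\<^bsub>M\<^esub> D) \<cdot>\<^bsub>N\<^esub>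
      (\<one>\<^bsub>N\<^esub> (Fo A) \<odot>\<^bsub>N\<^esub> phi B D) \<cdot>\<^bsub>N\<^esub> Assoc N (Fo A) (Fo B) (Fo D)) \<cdot>\<^bsub>N\<^esub> ((u \<odot>\<^bsub>N\<^esub> v) \<odot>\<^bsub>N\<^esub> w)"
    using N.Assoc_nat_arr [of u v w] assms by simp
  also have "\<dots> = ?R"
    unfolding phi_Assoc [OF assms(1-3)] using assms by simp
  finally show ?thesis .
qed

lemma phi_LUnit_arr:
  assumes "A \<in> Obj M"
  shows "Fa (LUnit M A) = phi (Unit M) A \<cdot>\<^bsub>N\<^esub> (phi0 \<odot>\<^bsub>N\<^esub> \<one>\<^bsub>N\<^esub> (Fo A)) \<cdot>\<^bsub>N\<^esub> inv\<^bsub>N\<^esub> (LUnit N (Fo A))"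
  by (rule N.iso_cancel_right [of "LUnit N (Fo A)"]) (use assms phi_LUnit in simp_all)

lemma phi_RUnit_arr:
  assumes "A \<in> Obj M"
  shows "Fa (RUnit M A) = phi A (Unit M) \<cdot>\<^bsub>N\<^esub> (\<one>\<^bsub>N\<^esub> (Fo A) \<odot>\<^bsub>N\<^esub> phi0) \<cdot>\<^bsub>N\<^esub> inv\<^bsub>N\<^esub> (RUnit N (Fo A))"
  by (rule N.iso_cancel_right [of "RUnit N (Fo A)"]) (use assms phi_RUnit in simp_all)

lemma Assoc_M_iso:
  assumes "A \<in> Obj M" "B \<in> Obj M" "D \<in> Obj M"
  shows "iso M (Assoc M A B D)"
proof (rule Fa_reflects_iso)
  let ?k = "phi A (B \<otimes>\<^bsub>M\<^esub> D) \<cdot>\<^bsub>N\<^esub> (\<one>\<^bsub>N\<^esub> (Fo A) \<odot>\<^bsub>N\<^esub> phi B D) \<cdot>\<^bsub>N\<^esub> Assoc N (Fo A) (Fo B) (Fo D)"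
  have "Fa (Assoc M A B D) =
      (phi (A \<otimes>\<^bsub>M\<^esub> B) D \<cdot>\<^bsub>N\<^esub> (phi A B \<odot>\<^bsub>N\<^esub> \<one>\<^bsub>N\<^esub> (Fo D))) \<cdot>\<^bsub>N\<^esub> inv\<^bsub>N\<^esub> ?k"
    by (rule N.iso_cancel_right [of ?k]) (use assms phi_Assoc in simp_all)
  then show "iso N (Fa (Assoc M A B D))" using assms by simp
qed (use assms in simp)

text \<open>
  Both sides of the pentagon are mapped to \<open>N\<close> and composed with \<open>?k\<close>, the comparison isomorphism from the
  product of four images bracketed to the left. Either side then brings \<open>phi\<close> to the left-hand bracketing
  \<open>?c\<close>, one associator at a time; by the pentagon in \<open>N\<close>, the associators in \<open>?k\<close> can be read along either path.
\<close>

lemma pentagon_M: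
  assumes "A \<in> Obj M" "B \<in> Obj M" "D \<in> Obj M" "E \<in> Obj M"
  shows "Assoc M A B (D \<otimes>\<^bsub>M\<^esub> E) \<cdot>\<^bsub>M\<^esub> Assoc M (A \<otimes>\<^bsub>M\<^esub> B) D E =
    (\<one>\<^bsub>M\<^esub> A \<odot>\<^bsub>M\<^esub> Assoc M B D E) \<cdot>\<^bsub>M\<^esub> Assoc M A (B \<otimes>\<^bsub>M\<^esub> D) E \<cdot>\<^bsub>M\<^esub> (Assoc M A B D \<odot>\<^bsub>M\<^esub> \<one>\<^bsub>M\<^esub> E)"
    (is "?l = ?r")
proof -
  let ?a = "Fo A" and ?b = "Fo B" and ?d = "Fo D" and ?e = "Fo E"
  let ?x = "Assoc N ?a ?b (?d \<otimes>\<^bsub>N\<^esub> ?e) \<cdot>\<^bsub>N\<^esub> Assoc N (?a \<otimes>\<^bsub>N\<^esub> ?b) ?d ?e"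
  let ?y = "\<one>\<^bsub>N\<^esub> ?a \<odot>\<^bsub>N\<^esub> (phi B (D \<otimes>\<^bsub>M\<^esub> E) \<cdot>\<^bsub>N\<^esub> (\<one>\<^bsub>N\<^esub> ?b \<odot>\<^bsub>N\<^esub> phi D E))"
  let ?k = "phi A (B \<otimes>\<^bsub>M\<^esub> (D \<otimes>\<^bsub>M\<^esub> E)) \<cdot>\<^bsub>N\<^esub> ?y \<cdot>\<^bsub>N\<^esub> ?x"
  let ?c = "phi ((A \<otimes>\<^bsub>M\<^esub> B) \<otimes>\<^bsub>M\<^esub> D) E \<cdot>\<^bsub>N\<^esub>
    ((phi (A \<otimes>\<^bsub>M\<^esub> B) D \<cdot>\<^bsub>N\<^esub> (phi A B \<odot>\<^bsub>N\<^esub> \<one>\<^bsub>N\<^esub> ?d)) \<odot>\<^bsub>N\<^esub> \<one>\<^bsub>N\<^esub> ?e)"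
  have 1: "Fa (Assoc M A B (D \<otimes>\<^bsub>M\<^esub> E)) \<cdot>\<^bsub>N\<^esub> phi A (B \<otimes>\<^bsub>M\<^esub> (D \<otimes>\<^bsub>M\<^esub> E)) \<cdot>\<^bsub>N\<^esub> ?y \<cdot>\<^bsub>N\<^esub>
      Assoc N ?a ?b (?d \<otimes>\<^bsub>N\<^esub> ?e) = phi (A \<otimes>\<^bsub>M\<^esub> B) (D \<otimes>\<^bsub>M\<^esub> E) \<cdot>\<^bsub>N\<^esub> (phi A B \<odot>\<^bsub>N\<^esub> phi D E)"
    by (subst phi_Assoc_arr) (use assms in simp_all)
  have 2: "Fa (Assoc M (A \<otimes>\<^bsub>M\<^esub> B) D E) \<cdot>\<^bsub>N\<^esub> phi (A \<otimes>\<^bsub>M\<^esub> B) (D \<otimes>\<^bsub>M\<^esub> E) \<cdot>\<^bsub>N\<^esub> (phi A B \<odot>\<^bsub>N\<^esub> phi D E) \<cdot>\<^bsub>N\<^esub>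
      Assoc N (?a \<otimes>\<^bsub>N\<^esub> ?b) ?d ?e = ?c"
    using phi_Assoc_arr [of "A \<otimes>\<^bsub>M\<^esub> B" D E "phi A B" "\<one>\<^bsub>N\<^esub> ?d" "\<one>\<^bsub>N\<^esub> ?e" "?a \<otimes>\<^bsub>N\<^esub> ?b" ?d ?e] assms
    by simp
  have "Fa ?l \<cdot>\<^bsub>N\<^esub> ?k = Fa (Assoc M (A \<otimes>\<^bsub>M\<^esub> B) D E) \<cdot>\<^bsub>N\<^esub>
      (Fa (Assoc M A B (D \<otimes>\<^bsub>M\<^esub> E)) \<cdot>\<^bsub>N\<^esub> phi A (B \<otimes>\<^bsub>M\<^esub> (D \<otimes>\<^bsub>M\<^esub> E)) \<cdot>\<^bsub>N\<^esub> ?y \<cdot>\<^bsub>N\<^esub>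
      Assoc N ?a ?b (?d \<otimes>\<^bsub>N\<^esub> ?e)) \<cdot>\<^bsub>N\<^esub> Assoc N (?a \<otimes>\<^bsub>N\<^esub> ?b) ?d ?e"
    using assms by simp
  also have "\<dots> = ?c"
    unfolding 1 using assms 2 by simp
  finally have L: "Fa ?l \<cdot>\<^bsub>N\<^esub> ?k = ?c" .
  have 3: "Fa (Assoc M B D E) \<cdot>\<^bsub>N\<^esub> phi B (D \<otimes>\<^bsub>M\<^esub> E) \<cdot>\<^bsub>N\<^esub> (\<one>\<^bsub>N\<^esub> ?b \<odot>\<^bsub>N\<^esub> phi D E) \<cdot>\<^bsub>N\<^esub> Assoc N ?b ?d ?e =
      phi (B \<otimes>\<^bsub>M\<^esub> D) E \<cdot>\<^bsub>N\<^esub> (phi B D \<odot>\<^bsub>N\<^esub> \<one>\<^bsub>N\<^esub> ?e)"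
    by (rule phi_Assoc) (use assms in simp_all)
  have 4: "Fa (Assoc M A (B \<otimes>\<^bsub>M\<^esub> D) E) \<cdot>\<^bsub>N\<^esub> phi A ((B \<otimes>\<^bsub>M\<^esub> D) \<otimes>\<^bsub>M\<^esub> E) \<cdot>\<^bsub>N\<^esub>
      (\<one>\<^bsub>N\<^esub> ?a \<odot>\<^bsub>N\<^esub> (phi (B \<otimes>\<^bsub>M\<^esub> D) E \<cdot>\<^bsub>N\<^esub> (phi B D \<odot>\<^bsub>N\<^esub> \<one>\<^bsub>N\<^esub> ?e))) \<cdot>\<^bsub>N\<^esub>
      Assoc N ?a (?b \<otimes>\<^bsub>N\<^esub> ?d) ?e =
      phi (A \<otimes>\<^bsub>M\<^esub> (B \<otimes>\<^bsub>M\<^esub> D)) E \<cdot>\<^bsub>N\<^esub> ((phi A (B \<otimes>\<^bsub>M\<^esub> D) \<cdot>\<^bsub>N\<^esub> (\<one>\<^bsub>N\<^esub> ?a \<odot>\<^bsub>N\<^esub> phi B D)) \<odot>\<^bsub>N\<^esub> \<one>\<^bsub>N\<^esub> ?e)"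
    by (rule phi_Assoc_arr) (use assms in simp_all)
  have "Fa ?r \<cdot>\<^bsub>N\<^esub> ?k = Fa (Assoc M A B D \<odot>\<^bsub>M\<^esub> \<one>\<^bsub>M\<^esub> E) \<cdot>\<^bsub>N\<^esub> Fa (Assoc M A (B \<otimes>\<^bsub>M\<^esub> D) E) \<cdot>\<^bsub>N\<^esub>
      phi A ((B \<otimes>\<^bsub>M\<^esub> D) \<otimes>\<^bsub>M\<^esub> E) \<cdot>\<^bsub>N\<^esub>
      (\<one>\<^bsub>N\<^esub> ?a \<odot>\<^bsub>N\<^esub> (Fa (Assoc M B D E) \<cdot>\<^bsub>N\<^esub> phi B (D \<otimes>\<^bsub>M\<^esub> E) \<cdot>\<^bsub>N\<^esub> (\<one>\<^bsub>N\<^esub> ?b \<odot>\<^bsub>N\<^esub> phi D E) \<cdot>\<^bsub>N\<^esub>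
        Assoc N ?b ?d ?e)) \<cdot>\<^bsub>N\<^esub>
      Assoc N ?a (?b \<otimes>\<^bsub>N\<^esub> ?d) ?e \<cdot>\<^bsub>N\<^esub> (Assoc N ?a ?b ?d \<odot>\<^bsub>N\<^esub> \<one>\<^bsub>N\<^esub> ?e)"
    using assms by (simp add: N.pentagon phi_nat_arr)
  also have "\<dots> = Fa (Assoc M A B D \<odot>\<^bsub>M\<^esub> \<one>\<^bsub>M\<^esub> E) \<cdot>\<^bsub>N\<^esub>
      (Fa (Assoc M A (B \<otimes>\<^bsub>M\<^esub> D) E) \<cdot>\<^bsub>N\<^esub> phi A ((B \<otimes>\<^bsub>M\<^esub> D) \<otimes>\<^bsub>M\<^esub> E) \<cdot>\<^bsub>N\<^esub>
      (\<one>\<^bsub>N\<^esub> ?a \<odot>\<^bsub>N\<^esub> (phi (B \<otimes>\<^bsub>M\<^esub> D) E \<cdot>\<^bsub>N\<^esub> (phi B D \<odot>\<^bsub>N\<^esub> \<one>\<^bsub>N\<^esub> ?e))) \<cdot>\<^bsub>N\<^esub>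
      Assoc N ?a (?b \<otimes>\<^bsub>N\<^esub> ?d) ?e) \<cdot>\<^bsub>N\<^esub> (Assoc N ?a ?b ?d \<odot>\<^bsub>N\<^esub> \<one>\<^bsub>N\<^esub> ?e)"
    unfolding 3 using assms by simp
  also have "\<dots> = phi ((A \<otimes>\<^bsub>M\<^esub> B) \<otimes>\<^bsub>M\<^esub> D) E \<cdot>\<^bsub>N\<^esub> ((Fa (Assoc M A B D) \<cdot>\<^bsub>N\<^esub>
      phi A (B \<otimes>\<^bsub>M\<^esub> D) \<cdot>\<^bsub>N\<^esub> (\<one>\<^bsub>N\<^esub> ?a \<odot>\<^bsub>N\<^esub> phi B D) \<cdot>\<^bsub>N\<^esub> Assoc N ?a ?b ?d) \<odot>\<^bsub>N\<^esub> \<one>\<^bsub>N\<^esub> ?e)"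
    unfolding 4 using assms by (simp add: phi_nat_arr)
  also have "\<dots> = ?c"
    using phi_Assoc assms by simp
  finally have R: "Fa ?r \<cdot>\<^bsub>N\<^esub> ?k = ?c" .
  show ?thesis
    by (rule Fa_inject_iso [of ?k]) (use assms L R in simp_all)
qed

text \<open>
  The composition with \<open>RUnit N\<close> in \<open>?k\<close> lets the triangle in \<open>N\<close> turn the right unitor into an associator and
  a left unitor, which the coherence of \<open>phi\<close> absorbs.
\<close>

lemma triangle_M:
  assumes "A \<in> Obj M" "B \<in> Obj M"
  shows "(\<one>\<^bsub>M\<^esub> A \<odot>\<^bsub>M\<^esub> LUnit M B) \<cdot>\<^bsub>M\<^esub> Assoc M A (Unit M) B = RUnit M A \<odot>\<^bsub>M\<^esub> \<one>\<^bsub>M\<^esub> B"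
    (is "?l = ?r")
proof -
  let ?a = "Fo A" and ?b = "Fo B" and ?I = "Unit N" and ?J = "Unit M"
  let ?k = "phi A B \<cdot>\<^bsub>N\<^esub> (RUnit N ?a \<odot>\<^bsub>N\<^esub> \<one>\<^bsub>N\<^esub> ?b)"
  have "Fa ?l \<cdot>\<^bsub>N\<^esub> ?k = Fa (Assoc M A ?J B) \<cdot>\<^bsub>N\<^esub> phi A (?J \<otimes>\<^bsub>M\<^esub> B) \<cdot>\<^bsub>N\<^esub>
      (\<one>\<^bsub>N\<^esub> ?a \<odot>\<^bsub>N\<^esub> (Fa (LUnit M B) \<cdot>\<^bsub>N\<^esub> LUnit N ?b)) \<cdot>\<^bsub>N\<^esub> Assoc N ?a ?I ?b"
    using assms by (simp add: phi_nat_arr flip: N.triangle)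
  also have "\<dots> = phi (A \<otimes>\<^bsub>M\<^esub> ?J) B \<cdot>\<^bsub>N\<^esub> ((phi A ?J \<cdot>\<^bsub>N\<^esub> (\<one>\<^bsub>N\<^esub> ?a \<odot>\<^bsub>N\<^esub> phi0)) \<odot>\<^bsub>N\<^esub> \<one>\<^bsub>N\<^esub> ?b)"
    unfolding phi_LUnit [OF assms(2)] by (rule phi_Assoc_arr) (use assms in simp_all)
  also have "\<dots> = Fa ?r \<cdot>\<^bsub>N\<^esub> ?k"
    unfolding phi_RUnit [OF assms(1), symmetric] using assms by (simp add: phi_nat_arr)
  finally have "Fa ?l \<cdot>\<^bsub>N\<^esub> ?k = Fa ?r \<cdot>\<^bsub>N\<^esub> ?k" .
  then show ?thesis
    by (rule Fa_inject_iso [rotated -1]) (use assms in simp_all)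
qed

text \<open>
  Apart from typing, each axiom is an equation of arrows or an invertibility, hence can be tested on images, where it becomes
  the same axiom of \<open>N\<close> conjugated by \<open>phi\<close>.
\<close>

theorem M_monoidal: "monoidal_category M"
proof
  show "\<one>\<^bsub>M\<^esub> A \<odot>\<^bsub>M\<^esub> \<one>\<^bsub>M\<^esub> B = \<one>\<^bsub>M\<^esub> (A \<otimes>\<^bsub>M\<^esub> B)" if "A \<in> Obj M" "B \<in> Obj M" for A B
    by (rule Fa_inject_iso [of "phi A B"]) (use that in \<open>simp_all add: phi_nat_arr\<close>)
next
  fix f A B g D f' A' B' g' D'
  assume "f \<in> hom M A B" "g \<in> hom M B D" "f' \<in> hom M A' B'" "g' \<in> hom M B' D'"
  then show "(g \<cdot>\<^bsub>M\<^esub> f) \<odot>\<^bsub>M\<^esub> (g' \<cdot>\<^bsub>M\<^esub> f') = (g \<odot>\<^bsub>M\<^esub> g') \<cdot>\<^bsub>M\<^esub> (f \<odot>\<^bsub>M\<^esub> f')"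
    by (intro Fa_inject_iso [of "phi D D'"]) (auto simp: phi_nat_arr)
next
  fix f A A' g B B' h D D'
  assume asm: "f \<in> hom M A A'" "g \<in> hom M B B'" "h \<in> hom M D D'"
  let ?l = "Assoc M A' B' D' \<cdot>\<^bsub>M\<^esub> ((f \<odot>\<^bsub>M\<^esub> g) \<odot>\<^bsub>M\<^esub> h)"
  let ?r = "(f \<odot>\<^bsub>M\<^esub> (g \<odot>\<^bsub>M\<^esub> h)) \<cdot>\<^bsub>M\<^esub> Assoc M A B D"
  let ?x = "Assoc N (Fo A') (Fo B') (Fo D')"
  let ?k = "phi A' (B' \<otimes>\<^bsub>M\<^esub> D') \<cdot>\<^bsub>N\<^esub> (\<one>\<^bsub>N\<^esub> (Fo A') \<odot>\<^bsub>N\<^esub> phi B' D') \<cdot>\<^bsub>N\<^esub> ?x"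
  have Objs: "A \<in> Obj M" "B \<in> Obj M" "D \<in> Obj M" "A' \<in> Obj M" "B' \<in> Obj M" "D' \<in> Obj M"
    using asm by auto
  have "Fa ?l \<cdot>\<^bsub>N\<^esub> ?k =
      Fa ((f \<odot>\<^bsub>M\<^esub> g) \<odot>\<^bsub>M\<^esub> h) \<cdot>\<^bsub>N\<^esub> (phi (A' \<otimes>\<^bsub>M\<^esub> B') D' \<cdot>\<^bsub>N\<^esub> (phi A' B' \<odot>\<^bsub>N\<^esub> \<one>\<^bsub>N\<^esub> (Fo D')))"
    using asm Objs phi_Assoc [of A' B' D'] by simp
  also have "\<dots> = phi (A \<otimes>\<^bsub>M\<^esub> B) D \<cdot>\<^bsub>N\<^esub> ((phi A B \<cdot>\<^bsub>N\<^esub> (Fa f \<odot>\<^bsub>N\<^esub> Fa g)) \<odot>\<^bsub>N\<^esub> Fa h)"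
    using asm Objs by (simp add: phi_nat_arr)
  also have "\<dots> = Fa (Assoc M A B D) \<cdot>\<^bsub>N\<^esub> phi A (B \<otimes>\<^bsub>M\<^esub> D) \<cdot>\<^bsub>N\<^esub>
      (Fa f \<odot>\<^bsub>N\<^esub> (phi B D \<cdot>\<^bsub>N\<^esub> (Fa g \<odot>\<^bsub>N\<^esub> Fa h))) \<cdot>\<^bsub>N\<^esub> ?x"
    by (rule phi_Assoc_arr [symmetric]) (use asm Objs in simp_all)
  also have "\<dots> = Fa ?r \<cdot>\<^bsub>N\<^esub> ?k"
    using asm Objs by (simp add: phi_nat_arr)
  finally have "Fa ?l \<cdot>\<^bsub>N\<^esub> ?k = Fa ?r \<cdot>\<^bsub>N\<^esub> ?k" .
  then show "?l = ?r"
    by (rule Fa_inject_iso [rotated -1]) (use asm Objs in simp_all)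
next
  show "iso M (LUnit M A)" if "A \<in> Obj M" for A
    using that by (intro Fa_reflects_iso) (simp_all add: phi_LUnit_arr)
  show "iso M (RUnit M A)" if "A \<in> Obj M" for A
    using that by (intro Fa_reflects_iso) (simp_all add: phi_RUnit_arr)
next
  fix f A B assume asm: "f \<in> hom M A B"
  have AB: "A \<in> Obj M" "B \<in> Obj M" using asm by auto
  have "LUnit N (Fo A) \<cdot>\<^bsub>N\<^esub> (\<one>\<^bsub>N\<^esub> (Unit N) \<odot>\<^bsub>N\<^esub> Fa f) = Fa f \<cdot>\<^bsub>N\<^esub> LUnit N (Fo B)"
    using asm by (intro N.LUnit_nat) simp
  then have "inv\<^bsub>N\<^esub> (LUnit N (Fo A)) \<cdot>\<^bsub>N\<^esub> Fa f = (\<one>\<^bsub>N\<^esub> (Unit N) \<odot>\<^bsub>N\<^esub> Fa f) \<cdot>\<^bsub>N\<^esub> inv\<^bsub>N\<^esub> (LUnit N (Fo B))"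
    using asm AB by (intro N.inv_square) simp_all
  then show "LUnit M B \<cdot>\<^bsub>M\<^esub> (\<one>\<^bsub>M\<^esub> (Unit M) \<odot>\<^bsub>M\<^esub> f) = f \<cdot>\<^bsub>M\<^esub> LUnit M A"
    using asm AB by (intro Fa_inject) (simp_all add: phi_LUnit_arr phi_nat_arr)
  have "RUnit N (Fo A) \<cdot>\<^bsub>N\<^esub> (Fa f \<odot>\<^bsub>N\<^esub> \<one>\<^bsub>N\<^esub> (Unit N)) = Fa f \<cdot>\<^bsub>N\<^esub> RUnit N (Fo B)"
    using asm by (intro N.RUnit_nat) simp
  then have "inv\<^bsub>N\<^esub> (RUnit N (Fo A)) \<cdot>\<^bsub>N\<^esub> Fa f = (Fa f \<odot>\<^bsub>N\<^esub> \<one>\<^bsub>N\<^esub> (Unit N)) \<cdot>\<^bsub>N\<^esub> inv\<^bsub>N\<^esub> (RUnit N (Fo B))"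
    using asm AB by (intro N.inv_square) simp_all
  then show "RUnit M B \<cdot>\<^bsub>M\<^esub> (f \<odot>\<^bsub>M\<^esub> \<one>\<^bsub>M\<^esub> (Unit M)) = f \<cdot>\<^bsub>M\<^esub> RUnit M A"
    using asm AB by (intro Fa_inject) (simp_all add: phi_RUnit_arr phi_nat_arr)
qed (simp_all add: Assoc_M_iso pentagon_M triangle_M)

end

section \<open>Pulling traces back\<close>

lemma trace_families_apply:
  assumes "T \<in> trace_families M" "X \<in> Obj M" "A \<in> Obj M" "B \<in> Obj M"
    "f \<in> hom M (A \<otimes>\<^bsub>M\<^esub> X) (B \<otimes>\<^bsub>M\<^esub> X)"
  shows "T X A B f \<in> hom M A B"
  using assms unfolding trace_families_def by (blast dest: PiE_mem)

lemma trace_families_eqI: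
  assumes "S \<in> trace_families M" "T \<in> trace_families M"
    and "\<And>X A B f. \<lbrakk>X \<in> Obj M; A \<in> Obj M; B \<in> Obj M; f \<in> hom M (A \<otimes>\<^bsub>M\<^esub> X) (B \<otimes>\<^bsub>M\<^esub> X)\<rbrakk>
      \<Longrightarrow> S X A B f = T X A B f"
  shows "S = T"
proof -
  note S = assms(1) [unfolded trace_families_def] and T = assms(2) [unfolded trace_families_def]
  show ?thesis
  proof (rule PiE_ext [OF S T])
    fix X assume X: "X \<in> Obj M"
    show "S X = T X"
    proof (rule PiE_ext [OF PiE_mem [OF S X] PiE_mem [OF T X]])
      fix A assume A: "A \<in> Obj M"
      show "S X A = T X A"
      proof (rule PiE_ext [OF PiE_mem [OF PiE_mem [OF S X] A] PiE_mem [OF PiE_mem [OF T X] A]])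
        fix B assume B: "B \<in> Obj M"
        show "S X A B = T X A B"
          by (rule PiE_ext [OF PiE_mem [OF PiE_mem [OF PiE_mem [OF S X] A] B]
                PiE_mem [OF PiE_mem [OF PiE_mem [OF T X] A] B]])
            (rule assms(3) [OF X A B])
      qed
    qed
  qed
qed

context right_trace
begin

lemma Tr_arr [simp]:
  assumes "X \<in> Obj M" "A \<in> Obj M" "B \<in> Obj M" "f \<in> Arr M" "Dom M f = A \<otimes> X" "Cod M f = B \<otimes> X"
  shows "Tr X A B f \<in> Arr M" "Dom M (Tr X A B f) = A" "Cod M (Tr X A B f) = B"
  using trace_families_apply [OF family, of X A B f] assms by simp_all

text \<open>
  Tightening moves \<open>g\<close> and \<open>h\<close> out of the trace; sliding carries \<open>inv k\<close> around the loop, where it cancels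
  against \<open>k\<close>. In this form the two axioms say that traces are invariant under change of all three objects by
  isomorphisms.
\<close>

lemma Tr_conjugate:
  assumes "iso M k" "f \<in> Arr M" "Dom M f = A \<otimes> Cod M k" "Cod M f = B \<otimes> Cod M k"
    "A \<in> Obj M" "B \<in> Obj M" "g \<in> Arr M" "Cod M g = A" "h \<in> Arr M" "Dom M h = B"
    "X = Dom M k" "Y = Cod M k" "A' = Dom M g" "B' = Cod M h"
  shows "Tr X A' B' ((h \<odot> inv k) \<cdot> f \<cdot> (g \<odot> k)) = h \<cdot> Tr Y A B f \<cdot> g"
proof -
  let ?f = "(h \<odot> \<one> Y) \<cdot> f \<cdot> (g \<odot> k)"
  have "Tr X A' B' ((h \<odot> inv k) \<cdot> f \<cdot> (g \<odot> k)) = Tr X A' B' ((\<one> B' \<odot> inv k) \<cdot> ?f)"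
    using assms by simp
  also have "\<dots> = Tr Y A' B' (?f \<cdot> (\<one> A' \<odot> inv k))"
    by (rule sliding) (use assms in auto)
  also have "\<dots> = Tr Y A' B' ((h \<odot> \<one> Y) \<cdot> f \<cdot> (g \<odot> \<one> Y))"
    using assms by simp
  also have "\<dots> = h \<cdot> Tr Y A B f \<cdot> g"
    by (rule tightening) (use assms in simp_all)
  finally show ?thesis .
qed

end

context contravariant_monoidal_embedding
begin

text \<open>
  The pullback is characterised rather than constructed, so that a trace defined by another formula can be
  recognised as one. As \<open>Fa\<close> is faithful, there is at most one such \<open>T\<close> for each \<open>Tr\<close>.
\<close>

definition pulled_back_trace ::
    "('p \<Rightarrow> 'p \<Rightarrow> 'p \<Rightarrow> 'n \<Rightarrow> 'n) \<Rightarrow> ('o \<Rightarrow> 'o \<Rightarrow> 'o \<Rightarrow> 'm \<Rightarrow> 'm) \<Rightarrow> bool"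
  where "pulled_back_trace Tr T \<longleftrightarrow> T \<in> trace_families M \<and>
    (\<forall>X \<in> Obj M. \<forall>A \<in> Obj M. \<forall>B \<in> Obj M. \<forall>f \<in> hom M (A \<otimes>\<^bsub>M\<^esub> X) (B \<otimes>\<^bsub>M\<^esub> X).
      Fa (T X A B f) =
        Tr (Fo X) (Fo B) (Fo A) (inv\<^bsub>N\<^esub> (phi A X) \<cdot>\<^bsub>N\<^esub> Fa f \<cdot>\<^bsub>N\<^esub> phi B X))"

text \<open>
  The coherence with \<open>Assoc\<close>, solved for the conjugation of arrows by associators that occurs in the axioms of
  vanishing and superposing.
\<close>

lemma phi_Assoc_inv:
  assumes "A \<in> Obj M" "B \<in> Obj M" "D \<in> Obj M"
  shows "inv\<^bsub>N\<^esub> (Fa (Assoc M A B D)) \<cdot>\<^bsub>N\<^esub> phi (A \<otimes>\<^bsub>M\<^esub> B) D =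
    phi A (B \<otimes>\<^bsub>M\<^esub> D) \<cdot>\<^bsub>N\<^esub> (\<one>\<^bsub>N\<^esub> (Fo A) \<odot>\<^bsub>N\<^esub> phi B D) \<cdot>\<^bsub>N\<^esub> Assoc N (Fo A) (Fo B) (Fo D) \<cdot>\<^bsub>N\<^esub>
    (inv\<^bsub>N\<^esub> (phi A B) \<odot>\<^bsub>N\<^esub> \<one>\<^bsub>N\<^esub> (Fo D))" (is "_ \<cdot>\<^bsub>N\<^esub> _ = ?r")
proof -
  have "Fa (Assoc M A B D) \<cdot>\<^bsub>N\<^esub> ?r = (Fa (Assoc M A B D) \<cdot>\<^bsub>N\<^esub> phi A (B \<otimes>\<^bsub>M\<^esub> D) \<cdot>\<^bsub>N\<^esub>
      (\<one>\<^bsub>N\<^esub> (Fo A) \<odot>\<^bsub>N\<^esub> phi B D) \<cdot>\<^bsub>N\<^esub> Assoc N (Fo A) (Fo B) (Fo D)) \<cdot>\<^bsub>N\<^esub>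
      (inv\<^bsub>N\<^esub> (phi A B) \<odot>\<^bsub>N\<^esub> \<one>\<^bsub>N\<^esub> (Fo D))"
    using assms by simp
  also have "\<dots> = phi (A \<otimes>\<^bsub>M\<^esub> B) D"
    unfolding phi_Assoc [OF assms] using assms by simp
  finally have "phi (A \<otimes>\<^bsub>M\<^esub> B) D = Fa (Assoc M A B D) \<cdot>\<^bsub>N\<^esub> ?r" ..
  then show ?thesis using assms Assoc_M_iso [OF assms] by simp
qed

text \<open>
  The functor reverses composition, so that the two factors of tightening change places, and the sliding of \<open>h\<close>
  becomes the sliding of \<open>Fa h\<close> read backwards. Vanishing needs \<open>Tr_conjugate\<close> in addition, because the
  image of the unit or of a product is only isomorphic to the unit or the product of the images.
\<close>

theorem right_trace_pulled_back:
  assumes "right_trace N Tr" and pb: "pulled_back_trace Tr T"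
  shows "right_trace M T"
proof -
  interpret Tr: right_trace N Tr by fact
  interpret MM: monoidal_category M by (rule M_monoidal)
  have T_family: "T \<in> trace_families M" using pb by (simp add: pulled_back_trace_def)
  have Fa_T: "Fa (T X A B f) =
      Tr (Fo X) (Fo B) (Fo A) (inv\<^bsub>N\<^esub> (phi A X) \<cdot>\<^bsub>N\<^esub> Fa f \<cdot>\<^bsub>N\<^esub> phi B X)"
    if "X \<in> Obj M" "A \<in> Obj M" "B \<in> Obj M" "f \<in> Arr M" "Dom M f = A \<otimes>\<^bsub>M\<^esub> X" "Cod M f = B \<otimes>\<^bsub>M\<^esub> X"
    for X A B f
    using pb that by (simp add: pulled_back_trace_def)
  have T_arr: "T X A B f \<in> Arr M" "Dom M (T X A B f) = A" "Cod M (T X A B f) = B"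
    if "X \<in> Obj M" "A \<in> Obj M" "B \<in> Obj M" "f \<in> Arr M" "Dom M f = A \<otimes>\<^bsub>M\<^esub> X" "Cod M f = B \<otimes>\<^bsub>M\<^esub> X"
    for X A B f
    using trace_families_apply [OF T_family, of X A B f] that by simp_all
  have phi_inv_nat: "(Fa f \<odot>\<^bsub>N\<^esub> Fa g) \<cdot>\<^bsub>N\<^esub> inv\<^bsub>N\<^esub> (phi A' B') = inv\<^bsub>N\<^esub> (phi A B) \<cdot>\<^bsub>N\<^esub> Fa (f \<odot>\<^bsub>M\<^esub> g)"
    if "f \<in> hom M A A'" "g \<in> hom M B B'" for f g A A' B B'
  proof -
    have "A \<in> Obj M" "A' \<in> Obj M" "B \<in> Obj M" "B' \<in> Obj M" using that by auto
    then show ?thesis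
      using that by (intro N.inv_square [symmetric]) (auto simp: phi_nat_arr)
  qed
  show ?thesis
  proof
    show "T \<in> trace_families M" by (rule T_family)
  next
    fix X g A' A f B h B'
    assume asm: "X \<in> Obj M" "g \<in> hom M A' A" "f \<in> hom M (A \<otimes>\<^bsub>M\<^esub> X) (B \<otimes>\<^bsub>M\<^esub> X)" "h \<in> hom M B B'"
    let ?f = "inv\<^bsub>N\<^esub> (phi A X) \<cdot>\<^bsub>N\<^esub> Fa f \<cdot>\<^bsub>N\<^esub> phi B X"
    have Objs: "A \<in> Obj M" "A' \<in> Obj M" "B \<in> Obj M" "B' \<in> Obj M" using asm by auto
    have nat: "inv\<^bsub>N\<^esub> (phi A' X) \<cdot>\<^bsub>N\<^esub> Fa (g \<odot>\<^bsub>M\<^esub> \<one>\<^bsub>M\<^esub> X) = (Fa g \<odot>\<^bsub>N\<^esub> \<one>\<^bsub>N\<^esub> (Fo X)) \<cdot>\<^bsub>N\<^esub> inv\<^bsub>N\<^esub> (phi A X)"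
      using phi_inv_nat [of g A' A "\<one>\<^bsub>M\<^esub> X" X X] asm by simp
    have "Fa (T X A' B' ((h \<odot>\<^bsub>M\<^esub> \<one>\<^bsub>M\<^esub> X) \<cdot>\<^bsub>M\<^esub> f \<cdot>\<^bsub>M\<^esub> (g \<odot>\<^bsub>M\<^esub> \<one>\<^bsub>M\<^esub> X))) =
        Tr (Fo X) (Fo B') (Fo A') ((inv\<^bsub>N\<^esub> (phi A' X) \<cdot>\<^bsub>N\<^esub> Fa (g \<odot>\<^bsub>M\<^esub> \<one>\<^bsub>M\<^esub> X)) \<cdot>\<^bsub>N\<^esub> Fa f \<cdot>\<^bsub>N\<^esub>
          phi B X \<cdot>\<^bsub>N\<^esub> (Fa h \<odot>\<^bsub>N\<^esub> \<one>\<^bsub>N\<^esub> (Fo X)))"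
      using asm Objs by (simp add: Fa_T phi_nat_arr)
    also have "\<dots> = Tr (Fo X) (Fo B') (Fo A')
        ((Fa g \<odot>\<^bsub>N\<^esub> \<one>\<^bsub>N\<^esub> (Fo X)) \<cdot>\<^bsub>N\<^esub> ?f \<cdot>\<^bsub>N\<^esub> (Fa h \<odot>\<^bsub>N\<^esub> \<one>\<^bsub>N\<^esub> (Fo X)))"
      unfolding nat using asm Objs by simp
    also have "\<dots> = Fa g \<cdot>\<^bsub>N\<^esub> Tr (Fo X) (Fo B) (Fo A) ?f \<cdot>\<^bsub>N\<^esub> Fa h"
      using asm Objs by (intro Tr.tightening) simp_all
    also have "\<dots> = Fa (h \<cdot>\<^bsub>M\<^esub> T X A B f \<cdot>\<^bsub>M\<^esub> g)"
      using asm Objs by (simp add: Fa_T T_arr)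
    finally show "T X A' B' ((h \<odot>\<^bsub>M\<^esub> \<one>\<^bsub>M\<^esub> X) \<cdot>\<^bsub>M\<^esub> f \<cdot>\<^bsub>M\<^esub> (g \<odot>\<^bsub>M\<^esub> \<one>\<^bsub>M\<^esub> X)) = h \<cdot>\<^bsub>M\<^esub> T X A B f \<cdot>\<^bsub>M\<^esub> g"
      by (rule Fa_inject [rotated -1]) (use asm Objs in \<open>simp_all add: T_arr\<close>)
  next
    fix A B f X Y h
    assume asm: "A \<in> Obj M" "B \<in> Obj M" "f \<in> hom M (A \<otimes>\<^bsub>M\<^esub> X) (B \<otimes>\<^bsub>M\<^esub> Y)" "h \<in> hom M Y X"
    let ?f = "inv\<^bsub>N\<^esub> (phi A X) \<cdot>\<^bsub>N\<^esub> Fa f \<cdot>\<^bsub>N\<^esub> phi B Y"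
    have XY: "X \<in> Obj M" "Y \<in> Obj M" using asm by auto
    have nat: "(\<one>\<^bsub>N\<^esub> (Fo A) \<odot>\<^bsub>N\<^esub> Fa h) \<cdot>\<^bsub>N\<^esub> inv\<^bsub>N\<^esub> (phi A X) = inv\<^bsub>N\<^esub> (phi A Y) \<cdot>\<^bsub>N\<^esub> Fa (\<one>\<^bsub>M\<^esub> A \<odot>\<^bsub>M\<^esub> h)"
      using phi_inv_nat [of "\<one>\<^bsub>M\<^esub> A" A A h Y X] asm by simp
    have "Fa (T X A B ((\<one>\<^bsub>M\<^esub> B \<odot>\<^bsub>M\<^esub> h) \<cdot>\<^bsub>M\<^esub> f)) = Tr (Fo X) (Fo B) (Fo A) (?f \<cdot>\<^bsub>N\<^esub> (\<one>\<^bsub>N\<^esub> (Fo B) \<odot>\<^bsub>N\<^esub> Fa h))"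
      using asm XY by (simp add: Fa_T phi_nat_arr)
    also have "\<dots> = Tr (Fo Y) (Fo B) (Fo A) ((\<one>\<^bsub>N\<^esub> (Fo A) \<odot>\<^bsub>N\<^esub> Fa h) \<cdot>\<^bsub>N\<^esub> ?f)"
      using asm XY by (intro Tr.sliding [symmetric]) simp_all
    also have "\<dots> = Tr (Fo Y) (Fo B) (Fo A)
        (((\<one>\<^bsub>N\<^esub> (Fo A) \<odot>\<^bsub>N\<^esub> Fa h) \<cdot>\<^bsub>N\<^esub> inv\<^bsub>N\<^esub> (phi A X)) \<cdot>\<^bsub>N\<^esub> Fa f \<cdot>\<^bsub>N\<^esub> phi B Y)"
      using asm XY by simp
    also have "\<dots> = Fa (T Y A B (f \<cdot>\<^bsub>M\<^esub> (\<one>\<^bsub>M\<^esub> A \<odot>\<^bsub>M\<^esub> h)))"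
      unfolding nat using asm XY by (simp add: Fa_T)
    finally show "T X A B ((\<one>\<^bsub>M\<^esub> B \<odot>\<^bsub>M\<^esub> h) \<cdot>\<^bsub>M\<^esub> f) = T Y A B (f \<cdot>\<^bsub>M\<^esub> (\<one>\<^bsub>M\<^esub> A \<odot>\<^bsub>M\<^esub> h))"
      by (rule Fa_inject [rotated -1]) (use asm XY in \<open>simp_all add: T_arr\<close>)
  next
    fix A B f
    assume asm: "A \<in> Obj M" "B \<in> Obj M" "f \<in> hom M (A \<otimes>\<^bsub>M\<^esub> Unit M) (B \<otimes>\<^bsub>M\<^esub> Unit M)"
    let ?f = "inv\<^bsub>N\<^esub> (phi A (Unit M)) \<cdot>\<^bsub>N\<^esub> Fa f \<cdot>\<^bsub>N\<^esub> phi B (Unit M)"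
    let ?g = "(\<one>\<^bsub>N\<^esub> (Fo A) \<odot>\<^bsub>N\<^esub> inv\<^bsub>N\<^esub> phi0) \<cdot>\<^bsub>N\<^esub> ?f \<cdot>\<^bsub>N\<^esub> (\<one>\<^bsub>N\<^esub> (Fo B) \<odot>\<^bsub>N\<^esub> phi0)"
    have "Fa (T (Unit M) A B f) = Tr (Unit N) (Fo B) (Fo A) ?g"
      using Tr.Tr_conjugate [of phi0 ?f "Fo B" "Fo A" "\<one>\<^bsub>N\<^esub> (Fo B)" "\<one>\<^bsub>N\<^esub> (Fo A)"] asm
      by (simp add: Fa_T)
    also have "\<dots> = RUnit N (Fo A) \<cdot>\<^bsub>N\<^esub> ?g \<cdot>\<^bsub>N\<^esub> inv\<^bsub>N\<^esub> (RUnit N (Fo B))"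
      using asm by (intro Tr.vanishing_Unit) simp_all
    also have "\<dots> = Fa (RUnit M B \<cdot>\<^bsub>M\<^esub> f \<cdot>\<^bsub>M\<^esub> inv\<^bsub>M\<^esub> (RUnit M A))"
      using asm by (simp add: phi_RUnit_arr)
    finally show "T (Unit M) A B f = RUnit M B \<cdot>\<^bsub>M\<^esub> f \<cdot>\<^bsub>M\<^esub> inv\<^bsub>M\<^esub> (RUnit M A)"
      by (rule Fa_inject [rotated -1]) (use asm in \<open>simp_all add: T_arr\<close>)
  next
    fix A B X Y f
    assume asm: "A \<in> Obj M" "B \<in> Obj M" "X \<in> Obj M" "Y \<in> Obj M"
      "f \<in> hom M (A \<otimes>\<^bsub>M\<^esub> (X \<otimes>\<^bsub>M\<^esub> Y)) (B \<otimes>\<^bsub>M\<^esub> (X \<otimes>\<^bsub>M\<^esub> Y))"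
    let ?h = "inv\<^bsub>M\<^esub> (Assoc M B X Y) \<cdot>\<^bsub>M\<^esub> f \<cdot>\<^bsub>M\<^esub> Assoc M A X Y"
    let ?f = "inv\<^bsub>N\<^esub> (phi A (X \<otimes>\<^bsub>M\<^esub> Y)) \<cdot>\<^bsub>N\<^esub> Fa f \<cdot>\<^bsub>N\<^esub> phi B (X \<otimes>\<^bsub>M\<^esub> Y)"
    let ?g = "(\<one>\<^bsub>N\<^esub> (Fo A) \<odot>\<^bsub>N\<^esub> inv\<^bsub>N\<^esub> (phi X Y)) \<cdot>\<^bsub>N\<^esub> ?f \<cdot>\<^bsub>N\<^esub> (\<one>\<^bsub>N\<^esub> (Fo B) \<odot>\<^bsub>N\<^esub> phi X Y)"
    let ?k = "inv\<^bsub>N\<^esub> (phi (A \<otimes>\<^bsub>M\<^esub> X) Y) \<cdot>\<^bsub>N\<^esub> Fa ?h \<cdot>\<^bsub>N\<^esub> phi (B \<otimes>\<^bsub>M\<^esub> X) Y"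
    let ?a = "\<lambda>A. Assoc N (Fo A) (Fo X) (Fo Y)"
    note coh = phi_Assoc_inv [OF _ asm(3,4)]
    have coh': "inv\<^bsub>N\<^esub> (phi (A \<otimes>\<^bsub>M\<^esub> X) Y) \<cdot>\<^bsub>N\<^esub> Fa (Assoc M A X Y) =
        (phi A X \<odot>\<^bsub>N\<^esub> \<one>\<^bsub>N\<^esub> (Fo Y)) \<cdot>\<^bsub>N\<^esub> inv\<^bsub>N\<^esub> (?a A) \<cdot>\<^bsub>N\<^esub>
        (\<one>\<^bsub>N\<^esub> (Fo A) \<odot>\<^bsub>N\<^esub> inv\<^bsub>N\<^esub> (phi X Y)) \<cdot>\<^bsub>N\<^esub> inv\<^bsub>N\<^esub> (phi A (X \<otimes>\<^bsub>M\<^esub> Y))"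
      using arg_cong [OF coh [OF asm(1)], of "\<lambda>k. inv\<^bsub>N\<^esub> k"] asm by simp
    \<comment> \<open>The trace over \<open>Y\<close> takes place over images of products; up to \<open>phi\<close> it is a trace over products of images.\<close>
    have k: "?k = (phi A X \<odot>\<^bsub>N\<^esub> \<one>\<^bsub>N\<^esub> (Fo Y)) \<cdot>\<^bsub>N\<^esub> (inv\<^bsub>N\<^esub> (?a A) \<cdot>\<^bsub>N\<^esub> ?g \<cdot>\<^bsub>N\<^esub> ?a B) \<cdot>\<^bsub>N\<^esub>
        (inv\<^bsub>N\<^esub> (phi B X) \<odot>\<^bsub>N\<^esub> \<one>\<^bsub>N\<^esub> (Fo Y))"
    proof -
      have "?k = (inv\<^bsub>N\<^esub> (phi (A \<otimes>\<^bsub>M\<^esub> X) Y) \<cdot>\<^bsub>N\<^esub> Fa (Assoc M A X Y)) \<cdot>\<^bsub>N\<^esub> Fa f \<cdot>\<^bsub>N\<^esub>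
          (inv\<^bsub>N\<^esub> (Fa (Assoc M B X Y)) \<cdot>\<^bsub>N\<^esub> phi (B \<otimes>\<^bsub>M\<^esub> X) Y)"
        using asm by simp
      also have "\<dots> = (phi A X \<odot>\<^bsub>N\<^esub> \<one>\<^bsub>N\<^esub> (Fo Y)) \<cdot>\<^bsub>N\<^esub> (inv\<^bsub>N\<^esub> (?a A) \<cdot>\<^bsub>N\<^esub> ?g \<cdot>\<^bsub>N\<^esub> ?a B) \<cdot>\<^bsub>N\<^esub>
          (inv\<^bsub>N\<^esub> (phi B X) \<odot>\<^bsub>N\<^esub> \<one>\<^bsub>N\<^esub> (Fo Y))"
        unfolding coh' coh [OF asm(2)] using asm by simp
      finally show ?thesis .
    qed
    have "Fa (T (X \<otimes>\<^bsub>M\<^esub> Y) A B f) = Tr (Fo X \<otimes>\<^bsub>N\<^esub> Fo Y) (Fo B) (Fo A) ?g"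
      using Tr.Tr_conjugate [of "phi X Y" ?f "Fo B" "Fo A" "\<one>\<^bsub>N\<^esub> (Fo B)" "\<one>\<^bsub>N\<^esub> (Fo A)"] asm
      by (simp add: Fa_T)
    also have "\<dots> = Tr (Fo X) (Fo B) (Fo A) (Tr (Fo Y) (Fo B \<otimes>\<^bsub>N\<^esub> Fo X) (Fo A \<otimes>\<^bsub>N\<^esub> Fo X)
        (inv\<^bsub>N\<^esub> (?a A) \<cdot>\<^bsub>N\<^esub> ?g \<cdot>\<^bsub>N\<^esub> ?a B))"
      using asm by (intro Tr.vanishing_TenO) simp_all
    also have "Tr (Fo Y) (Fo B \<otimes>\<^bsub>N\<^esub> Fo X) (Fo A \<otimes>\<^bsub>N\<^esub> Fo X) (inv\<^bsub>N\<^esub> (?a A) \<cdot>\<^bsub>N\<^esub> ?g \<cdot>\<^bsub>N\<^esub> ?a B) =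
        inv\<^bsub>N\<^esub> (phi A X) \<cdot>\<^bsub>N\<^esub> Fa (T Y (A \<otimes>\<^bsub>M\<^esub> X) (B \<otimes>\<^bsub>M\<^esub> X) ?h) \<cdot>\<^bsub>N\<^esub> phi B X"
    proof -
      have "Fa (T Y (A \<otimes>\<^bsub>M\<^esub> X) (B \<otimes>\<^bsub>M\<^esub> X) ?h) = Tr (Fo Y) (Fo (B \<otimes>\<^bsub>M\<^esub> X)) (Fo (A \<otimes>\<^bsub>M\<^esub> X)) ?k"
        using asm Assoc_M_iso by (intro Fa_T) simp_all
      also have "\<dots> = phi A X \<cdot>\<^bsub>N\<^esub> Tr (Fo Y) (Fo B \<otimes>\<^bsub>N\<^esub> Fo X) (Fo A \<otimes>\<^bsub>N\<^esub> Fo X)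
          (inv\<^bsub>N\<^esub> (?a A) \<cdot>\<^bsub>N\<^esub> ?g \<cdot>\<^bsub>N\<^esub> ?a B) \<cdot>\<^bsub>N\<^esub> inv\<^bsub>N\<^esub> (phi B X)"
        unfolding k using asm by (intro Tr.tightening) simp_all
      finally show ?thesis using asm by simp
    qed
    also have "Tr (Fo X) (Fo B) (Fo A) \<dots> = Fa (T X A B (T Y (A \<otimes>\<^bsub>M\<^esub> X) (B \<otimes>\<^bsub>M\<^esub> X) ?h))"
      using asm by (intro Fa_T [symmetric]) (simp_all add: T_arr)
    finally show "T (X \<otimes>\<^bsub>M\<^esub> Y) A B f = T X A B (T Y (A \<otimes>\<^bsub>M\<^esub> X) (B \<otimes>\<^bsub>M\<^esub> X) ?h)"
      by (rule Fa_inject [rotated -1]) (use asm in \<open>simp_all add: T_arr\<close>)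
  next
    fix A B X g C D f
    assume asm: "A \<in> Obj M" "B \<in> Obj M" "X \<in> Obj M" "g \<in> hom M C D"
      "f \<in> hom M (A \<otimes>\<^bsub>M\<^esub> X) (B \<otimes>\<^bsub>M\<^esub> X)"
    have CD: "C \<in> Obj M" "D \<in> Obj M" using asm by auto
    let ?h = "inv\<^bsub>M\<^esub> (Assoc M D B X) \<cdot>\<^bsub>M\<^esub> (g \<odot>\<^bsub>M\<^esub> f) \<cdot>\<^bsub>M\<^esub> Assoc M C A X"
    let ?f = "inv\<^bsub>N\<^esub> (phi A X) \<cdot>\<^bsub>N\<^esub> Fa f \<cdot>\<^bsub>N\<^esub> phi B X"
    let ?k = "inv\<^bsub>N\<^esub> (phi (C \<otimes>\<^bsub>M\<^esub> A) X) \<cdot>\<^bsub>N\<^esub> Fa ?h \<cdot>\<^bsub>N\<^esub> phi (D \<otimes>\<^bsub>M\<^esub> B) X"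
    let ?a = "\<lambda>C A. Assoc N (Fo C) (Fo A) (Fo X)"
    let ?m = "inv\<^bsub>N\<^esub> (?a C A) \<cdot>\<^bsub>N\<^esub> (Fa g \<odot>\<^bsub>N\<^esub> ?f) \<cdot>\<^bsub>N\<^esub> ?a D B"
    note coh = phi_Assoc_inv [OF _ _ asm(3)]
    have coh': "inv\<^bsub>N\<^esub> (phi (C \<otimes>\<^bsub>M\<^esub> A) X) \<cdot>\<^bsub>N\<^esub> Fa (Assoc M C A X) =
        (phi C A \<odot>\<^bsub>N\<^esub> \<one>\<^bsub>N\<^esub> (Fo X)) \<cdot>\<^bsub>N\<^esub> inv\<^bsub>N\<^esub> (?a C A) \<cdot>\<^bsub>N\<^esub>
        (\<one>\<^bsub>N\<^esub> (Fo C) \<odot>\<^bsub>N\<^esub> inv\<^bsub>N\<^esub> (phi A X)) \<cdot>\<^bsub>N\<^esub> inv\<^bsub>N\<^esub> (phi C (A \<otimes>\<^bsub>M\<^esub> X))"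
      using arg_cong [OF coh [OF CD(1) asm(1)], of "\<lambda>k. inv\<^bsub>N\<^esub> k"] asm CD by simp
    have k: "?k = (phi C A \<odot>\<^bsub>N\<^esub> \<one>\<^bsub>N\<^esub> (Fo X)) \<cdot>\<^bsub>N\<^esub> ?m \<cdot>\<^bsub>N\<^esub> (inv\<^bsub>N\<^esub> (phi D B) \<odot>\<^bsub>N\<^esub> \<one>\<^bsub>N\<^esub> (Fo X))"
    proof -
      have "?k = (inv\<^bsub>N\<^esub> (phi (C \<otimes>\<^bsub>M\<^esub> A) X) \<cdot>\<^bsub>N\<^esub> Fa (Assoc M C A X)) \<cdot>\<^bsub>N\<^esub> Fa (g \<odot>\<^bsub>M\<^esub> f) \<cdot>\<^bsub>N\<^esub>
          (inv\<^bsub>N\<^esub> (Fa (Assoc M D B X)) \<cdot>\<^bsub>N\<^esub> phi (D \<otimes>\<^bsub>M\<^esub> B) X)"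
        using asm CD by simp
      also have "\<dots> = (phi C A \<odot>\<^bsub>N\<^esub> \<one>\<^bsub>N\<^esub> (Fo X)) \<cdot>\<^bsub>N\<^esub> ?m \<cdot>\<^bsub>N\<^esub> (inv\<^bsub>N\<^esub> (phi D B) \<odot>\<^bsub>N\<^esub> \<one>\<^bsub>N\<^esub> (Fo X))"
        unfolding coh' coh [OF CD(2) asm(2)] using asm CD by (simp add: phi_nat_arr)
      finally show ?thesis .
    qed
    have "Fa (T X (C \<otimes>\<^bsub>M\<^esub> A) (D \<otimes>\<^bsub>M\<^esub> B) ?h) = Tr (Fo X) (Fo (D \<otimes>\<^bsub>M\<^esub> B)) (Fo (C \<otimes>\<^bsub>M\<^esub> A)) ?k"
      using asm CD by (intro Fa_T) simp_all
    also have "\<dots> = phi C A \<cdot>\<^bsub>N\<^esub> Tr (Fo X) (Fo D \<otimes>\<^bsub>N\<^esub> Fo B) (Fo C \<otimes>\<^bsub>N\<^esub> Fo A) ?m \<cdot>\<^bsub>N\<^esub> inv\<^bsub>N\<^esub> (phi D B)"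
      unfolding k using asm CD by (intro Tr.tightening) simp_all
    also have "Tr (Fo X) (Fo D \<otimes>\<^bsub>N\<^esub> Fo B) (Fo C \<otimes>\<^bsub>N\<^esub> Fo A) ?m = Fa g \<odot>\<^bsub>N\<^esub> Tr (Fo X) (Fo B) (Fo A) ?f"
      using asm CD by (intro Tr.superposing) simp_all
    also have "\<dots> = Fa g \<odot>\<^bsub>N\<^esub> Fa (T X A B f)"
      using asm by (simp add: Fa_T)
    also have "phi C A \<cdot>\<^bsub>N\<^esub> \<dots> \<cdot>\<^bsub>N\<^esub> inv\<^bsub>N\<^esub> (phi D B) = Fa (g \<odot>\<^bsub>M\<^esub> T X A B f)"
      using asm CD phi_inv_nat [of g C D "T X A B f" A B] by (simp add: T_arr)
    finally show "T X (C \<otimes>\<^bsub>M\<^esub> A) (D \<otimes>\<^bsub>M\<^esub> B) ?h = g \<odot>\<^bsub>M\<^esub> T X A B f"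
      by (rule Fa_inject [rotated -1]) (use asm CD in \<open>simp_all add: T_arr\<close>)
  qed
qed

end

text \<open>
  Pulling back along \<open>F\<close> and then along \<open>G\<close> traces \<open>Fa (Ga f)\<close>, conjugated by the comparison
  maps, over \<open>Fo (Go X)\<close>. Naturality and monoidality of
  \<open>eps\<close> identify this with \<open>f\<close> conjugated by \<open>eps\<close>, and conjugation passes through a trace.
\<close>

lemma pulled_back_trace_inverse:
  assumes F: "contravariant_monoidal_embedding M N Fo Fa phi phi0"
    and G: "contravariant_monoidal_embedding N M Go Ga psi psi0"
    and eps: "\<And>A. A \<in> Obj N \<Longrightarrow> eps A \<in> hom N A (Fo (Go A))" "\<And>A. A \<in> Obj N \<Longrightarrow> iso N (eps A)"
    and eps_nat: "\<And>f A B. f \<in> hom N A B \<Longrightarrow> Fa (Ga f) \<cdot>\<^bsub>N\<^esub> eps A = eps B \<cdot>\<^bsub>N\<^esub> f"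
    and eps_TenO: "\<And>A B. \<lbrakk>A \<in> Obj N; B \<in> Obj N\<rbrakk> \<Longrightarrow>
      Fa (psi A B) \<cdot>\<^bsub>N\<^esub> eps (A \<otimes>\<^bsub>N\<^esub> B) = phi (Go A) (Go B) \<cdot>\<^bsub>N\<^esub> (eps A \<odot>\<^bsub>N\<^esub> eps B)"
    and Tr: "right_trace N Tr"
    and T: "contravariant_monoidal_embedding.pulled_back_trace M N Fo Fa phi Tr T"
    and S: "contravariant_monoidal_embedding.pulled_back_trace N M Go Ga psi T S"
  shows "S = Tr"
proof -
  interpret F: contravariant_monoidal_embedding M N Fo Fa phi phi0 by fact
  interpret G: contravariant_monoidal_embedding N M Go Ga psi psi0 by fact
  interpret Tr: right_trace N Tr by fact
  interpret MM: monoidal_category M by (rule F.M_monoidal)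
  have eps_arr [simp]: "eps A \<in> Arr N" "Dom N (eps A) = A" "Cod N (eps A) = Fo (Go A)"
    if "A \<in> Obj N" for A
    using eps(1) [OF that] by simp_all
  have T_family: "T \<in> trace_families M" and S_family: "S \<in> trace_families N"
    using T S by (simp_all add: F.pulled_back_trace_def G.pulled_back_trace_def)
  show ?thesis
  proof (rule trace_families_eqI [OF S_family Tr.family])
    fix X A B f
    assume asm: "X \<in> Obj N" "A \<in> Obj N" "B \<in> Obj N" "f \<in> hom N (A \<otimes>\<^bsub>N\<^esub> X) (B \<otimes>\<^bsub>N\<^esub> X)"
    let ?g = "inv\<^bsub>M\<^esub> (psi A X) \<cdot>\<^bsub>M\<^esub> Ga f \<cdot>\<^bsub>M\<^esub> psi B X"
    let ?h = "inv\<^bsub>N\<^esub> (phi (Go B) (Go X)) \<cdot>\<^bsub>N\<^esub> Fa ?g \<cdot>\<^bsub>N\<^esub> phi (Go A) (Go X)"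
    have conj: "inv\<^bsub>N\<^esub> (Fa (psi D X)) \<cdot>\<^bsub>N\<^esub> phi (Go D) (Go X) =
        eps (D \<otimes>\<^bsub>N\<^esub> X) \<cdot>\<^bsub>N\<^esub> (inv\<^bsub>N\<^esub> (eps D) \<odot>\<^bsub>N\<^esub> inv\<^bsub>N\<^esub> (eps X))" if D: "D \<in> Obj N" for D
      using F.N.inv_square [of "eps D \<odot>\<^bsub>N\<^esub> eps X" "Fa (psi D X)" "phi (Go D) (Go X)" "eps (D \<otimes>\<^bsub>N\<^esub> X)"]
        D asm eps eps_TenO [OF D asm(1)] by simp
    have conj': "inv\<^bsub>N\<^esub> (phi (Go B) (Go X)) \<cdot>\<^bsub>N\<^esub> Fa (psi B X) =
        (eps B \<odot>\<^bsub>N\<^esub> eps X) \<cdot>\<^bsub>N\<^esub> inv\<^bsub>N\<^esub> (eps (B \<otimes>\<^bsub>N\<^esub> X))"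
      using arg_cong [OF conj [OF asm(3)], of "\<lambda>k. inv\<^bsub>N\<^esub> k"] asm eps by simp
    have GF: "Fa (Ga k) = eps D' \<cdot>\<^bsub>N\<^esub> k \<cdot>\<^bsub>N\<^esub> inv\<^bsub>N\<^esub> (eps D)" if k: "k \<in> hom N D D'" for k D D'
      by (rule F.N.iso_cancel_right [of "eps D"]) (use k eps eps_nat [OF k] in auto)
    have h: "?h = (eps B \<odot>\<^bsub>N\<^esub> eps X) \<cdot>\<^bsub>N\<^esub> f \<cdot>\<^bsub>N\<^esub> (inv\<^bsub>N\<^esub> (eps A) \<odot>\<^bsub>N\<^esub> inv\<^bsub>N\<^esub> (eps X))"
    proof -
      have "?h = (inv\<^bsub>N\<^esub> (phi (Go B) (Go X)) \<cdot>\<^bsub>N\<^esub> Fa (psi B X)) \<cdot>\<^bsub>N\<^esub> Fa (Ga f) \<cdot>\<^bsub>N\<^esub>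
          (inv\<^bsub>N\<^esub> (Fa (psi A X)) \<cdot>\<^bsub>N\<^esub> phi (Go A) (Go X))"
        using asm by simp
      then show ?thesis
        unfolding conj [OF asm(2)] conj' GF [OF asm(4)] using asm eps by simp
    qed
    have T_arr: "T (Go X) (Go B) (Go A) ?g \<in> hom M (Go B) (Go A)"
      using asm by (intro trace_families_apply [OF T_family]) simp_all
    have S_arr: "S X A B f \<in> hom N A B" using asm by (intro trace_families_apply [OF S_family])
    have "Fa (Ga (S X A B f)) = Fa (T (Go X) (Go B) (Go A) ?g)"
      using S asm unfolding G.pulled_back_trace_def by simp
    also have "\<dots> = Tr (Fo (Go X)) (Fo (Go A)) (Fo (Go B)) ?h"
      using T asm unfolding F.pulled_back_trace_def by simp
    also have "\<dots> = eps B \<cdot>\<^bsub>N\<^esub> Tr X A B f \<cdot>\<^bsub>N\<^esub> inv\<^bsub>N\<^esub> (eps A)"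
      unfolding h
      using Tr.Tr_conjugate [of "inv\<^bsub>N\<^esub> (eps X)" f A B "inv\<^bsub>N\<^esub> (eps A)" "eps B"] asm eps by simp
    finally have "Fa (Ga (S X A B f)) = Fa (Ga (Tr X A B f))"
      using asm GF [of "Tr X A B f" A B] by simp
    then have "Ga (S X A B f) = Ga (Tr X A B f)"
      by (rule F.Fa_inject [rotated -1]) (use asm S_arr in auto)
    then show "S X A B f = Tr X A B f"
      by (rule G.Fa_inject [rotated -1]) (use asm S_arr in auto)
  qed
qed

section \<open>The duality of a star-autonomous category\<close>

context star_autonomous_category
begin

declare Bot_Obj [simp] RDual_Obj [simp] LDual_Obj [simp] LRunit_iso [simp] RLunit_iso [simp]

text \<open>
  By naturality, the two bijections are determined by the evaluations \<open>REval\<close> and \<open>LEval\<close>. Equations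
  between arrows into duals can therefore be checked after evaluation, where the interchange law applies.
\<close>

lemma REval_arr [simp]:
  assumes "A \<in> Obj C"
  shows "REval C A \<in> Arr C" "Dom C (REval C A) = A \<otimes> RDual C A" "Cod C (REval C A) = Bot C"
  using bij_betw_apply [OF RCur_bij [of A "RDual C A"], of "\<one> (RDual C A)"] assms
  by (simp_all add: REval_def)

lemma LEval_arr [simp]:
  assumes "A \<in> Obj C"
  shows "LEval C A \<in> Arr C" "Dom C (LEval C A) = LDual C A \<otimes> A" "Cod C (LEval C A) = Bot C"
  using bij_betw_apply [OF LCur_bij [of A "LDual C A"], of "\<one> (LDual C A)"] assms
  by (simp_all add: LEval_def)

lemma RCur_eq:
  assumes "A \<in> Obj C" "f \<in> Arr C" "Cod C f = RDual C A" "X = Dom C f"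
  shows "RCur C A X f = REval C A \<cdot> (\<one> A \<odot> f)"
  using RCur_nat [of A f X "RDual C A" "\<one> (RDual C A)"] assms by (simp add: REval_def)

lemma LCur_eq:
  assumes "A \<in> Obj C" "f \<in> Arr C" "Cod C f = LDual C A" "X = Dom C f"
  shows "LCur C A X f = LEval C A \<cdot> (f \<odot> \<one> A)"
  using LCur_nat [of A f X "LDual C A" "\<one> (LDual C A)"] assms by (simp add: LEval_def)

lemma RUncur_arr:
  assumes "A \<in> Obj C" "X \<in> Obj C" "k \<in> Arr C" "Dom C k = A \<otimes> X" "Cod C k = Bot C"
  shows "RUncur C A X k \<in> Arr C" "Dom C (RUncur C A X k) = X" "Cod C (RUncur C A X k) = RDual C A"
    "REval C A \<cdot> (\<one> A \<odot> RUncur C A X k) = k"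
proof -
  note bij = RCur_bij [OF assms(1,2)]
  have "RUncur C A X k \<in> hom C X (RDual C A)"
    using bij_betw_apply [OF bij_betw_the_inv_into [OF bij], of k] assms by (simp add: RUncur_def)
  then show *: "RUncur C A X k \<in> Arr C" "Dom C (RUncur C A X k) = X" "Cod C (RUncur C A X k) = RDual C A"
    by simp_all
  have "RCur C A X (RUncur C A X k) = k"
    using f_the_inv_into_f_bij_betw [OF bij, of k] assms by (simp add: RUncur_def)
  then show "REval C A \<cdot> (\<one> A \<odot> RUncur C A X k) = k"
    using RCur_eq [of A "RUncur C A X k" X] * assms by simp
qed

lemma LUncur_arr:
  assumes "A \<in> Obj C" "X \<in> Obj C" "k \<in> Arr C" "Dom C k = X \<otimes> A" "Cod C k = Bot C"
  shows "LUncur C A X k \<in> Arr C" "Dom C (LUncur C A X k) = X" "Cod C (LUncur C A X k) = LDual C A"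
    "LEval C A \<cdot> (LUncur C A X k \<odot> \<one> A) = k"
proof -
  note bij = LCur_bij [OF assms(1,2)]
  have "LUncur C A X k \<in> hom C X (LDual C A)"
    using bij_betw_apply [OF bij_betw_the_inv_into [OF bij], of k] assms by (simp add: LUncur_def)
  then show *: "LUncur C A X k \<in> Arr C" "Dom C (LUncur C A X k) = X" "Cod C (LUncur C A X k) = LDual C A"
    by simp_all
  have "LCur C A X (LUncur C A X k) = k"
    using f_the_inv_into_f_bij_betw [OF bij, of k] assms by (simp add: LUncur_def)
  then show "LEval C A \<cdot> (LUncur C A X k \<odot> \<one> A) = k"
    using LCur_eq [of A "LUncur C A X k" X] * assms by simp
qed

lemma REval_inject:
  assumes "REval C A \<cdot> (\<one> A \<odot> f) = REval C A \<cdot> (\<one> A \<odot> g)" "A \<in> Obj C" "f \<in> Arr C" "g \<in> Arr C"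
    "Cod C f = RDual C A" "Cod C g = RDual C A" "Dom C f = Dom C g"
  shows "f = g"
proof -
  have "RCur C A (Dom C g) f = RCur C A (Dom C g) g"
    using assms RCur_eq [of A f "Dom C g"] RCur_eq [of A g "Dom C g"] by simp
  then show ?thesis
    using RCur_bij [of A "Dom C g"] assms unfolding bij_betw_def inj_on_def by simp
qed

lemma LEval_inject:
  assumes "LEval C A \<cdot> (f \<odot> \<one> A) = LEval C A \<cdot> (g \<odot> \<one> A)" "A \<in> Obj C" "f \<in> Arr C" "g \<in> Arr C"
    "Cod C f = LDual C A" "Cod C g = LDual C A" "Dom C f = Dom C g"
  shows "f = g"
proof -
  have "LCur C A (Dom C g) f = LCur C A (Dom C g) g"
    using assms LCur_eq [of A f "Dom C g"] LCur_eq [of A g "Dom C g"] by simp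
  then show ?thesis
    using LCur_bij [of A "Dom C g"] assms unfolding bij_betw_def inj_on_def by simp
qed

lemma RDualA_arr [simp]:
  assumes "f \<in> Arr C"
  shows "RDualA C f \<in> Arr C" "Dom C (RDualA C f) = RDual C (Cod C f)"
    "Cod C (RDualA C f) = RDual C (Dom C f)"
  using assms unfolding RDualA_def by (simp_all add: RUncur_arr)

lemma LDualA_arr [simp]:
  assumes "f \<in> Arr C"
  shows "LDualA C f \<in> Arr C" "Dom C (LDualA C f) = LDual C (Cod C f)"
    "Cod C (LDualA C f) = LDual C (Dom C f)"
  using assms unfolding LDualA_def by (simp_all add: LUncur_arr)

text \<open>Evaluation is dinatural. Together with injectivity of currying, this determines the duals of arrows.\<close>

lemma REval_RDualA:
  assumes "f \<in> Arr C" "Dom C f = A" "Cod C f = B"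
  shows "REval C A \<cdot> (\<one> A \<odot> RDualA C f) = REval C B \<cdot> (f \<odot> \<one> (RDual C B))"
    "h \<in> Arr C \<Longrightarrow> Cod C h = RDual C B \<Longrightarrow> REval C A \<cdot> (\<one> A \<odot> (RDualA C f \<cdot> h)) = REval C B \<cdot> (f \<odot> h)"
proof -
  have AB: "A \<in> Obj C" "B \<in> Obj C" using assms by auto
  show *: "REval C A \<cdot> (\<one> A \<odot> RDualA C f) = REval C B \<cdot> (f \<odot> \<one> (RDual C B))"
    unfolding RDualA_def using assms AB by (simp add: RUncur_arr)
  assume h: "h \<in> Arr C" "Cod C h = RDual C B"
  have "REval C A \<cdot> (\<one> A \<odot> (RDualA C f \<cdot> h)) = (REval C A \<cdot> (\<one> A \<odot> RDualA C f)) \<cdot> (\<one> A \<odot> h)"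
    using assms AB h by simp
  also have "\<dots> = REval C B \<cdot> (f \<odot> h)"
    unfolding * using assms AB h by simp
  finally show "REval C A \<cdot> (\<one> A \<odot> (RDualA C f \<cdot> h)) = REval C B \<cdot> (f \<odot> h)" .
qed

lemma LEval_LDualA:
  assumes "f \<in> Arr C" "Dom C f = A" "Cod C f = B"
  shows "LEval C A \<cdot> (LDualA C f \<odot> \<one> A) = LEval C B \<cdot> (\<one> (LDual C B) \<odot> f)"
    "h \<in> Arr C \<Longrightarrow> Cod C h = LDual C B \<Longrightarrow> LEval C A \<cdot> ((LDualA C f \<cdot> h) \<odot> \<one> A) = LEval C B \<cdot> (h \<odot> f)"
proof -
  have AB: "A \<in> Obj C" "B \<in> Obj C" using assms by auto
  show *: "LEval C A \<cdot> (LDualA C f \<odot> \<one> A) = LEval C B \<cdot> (\<one> (LDual C B) \<odot> f)"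
    unfolding LDualA_def using assms AB by (simp add: LUncur_arr)
  assume h: "h \<in> Arr C" "Cod C h = LDual C B"
  have "LEval C A \<cdot> ((LDualA C f \<cdot> h) \<odot> \<one> A) = (LEval C A \<cdot> (LDualA C f \<odot> \<one> A)) \<cdot> (h \<odot> \<one> A)"
    using assms AB h by simp
  also have "\<dots> = LEval C B \<cdot> (h \<odot> f)"
    unfolding * using assms AB h by simp
  finally show "LEval C A \<cdot> ((LDualA C f \<cdot> h) \<odot> \<one> A) = LEval C B \<cdot> (h \<odot> f)" .
qed

lemma RDualA_eqI:
  assumes "REval C (Dom C f) \<cdot> (\<one> (Dom C f) \<odot> k) = REval C (Cod C f) \<cdot> (f \<odot> \<one> (RDual C (Cod C f)))"
    "f \<in> Arr C" "k \<in> Arr C" "Dom C k = RDual C (Cod C f)" "Cod C k = RDual C (Dom C f)"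
  shows "RDualA C f = k"
  by (rule REval_inject [of "Dom C f"])
    (simp_all only: REval_RDualA(1) [OF assms(2) refl refl] assms RDualA_arr Dom_Cod_Obj)

lemma LDualA_eqI:
  assumes "LEval C (Dom C f) \<cdot> (k \<odot> \<one> (Dom C f)) = LEval C (Cod C f) \<cdot> (\<one> (LDual C (Cod C f)) \<odot> f)"
    "f \<in> Arr C" "k \<in> Arr C" "Dom C k = LDual C (Cod C f)" "Cod C k = LDual C (Dom C f)"
  shows "LDualA C f = k"
  by (rule LEval_inject [of "Dom C f"])
    (simp_all only: LEval_LDualA(1) [OF assms(2) refl refl] assms LDualA_arr Dom_Cod_Obj)

lemma RDualA_Idn [simp]: "A \<in> Obj C \<Longrightarrow> RDualA C (\<one> A) = \<one> (RDual C A)"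
  by (rule RDualA_eqI) simp_all

lemma LDualA_Idn [simp]: "A \<in> Obj C \<Longrightarrow> LDualA C (\<one> A) = \<one> (LDual C A)"
  by (rule LDualA_eqI) simp_all

lemma RDualA_Comp [simp]:
  assumes "f \<in> Arr C" "g \<in> Arr C" "Dom C g = Cod C f"
  shows "RDualA C (g \<cdot> f) = RDualA C f \<cdot> RDualA C g"
proof (rule RDualA_eqI)
  let ?A = "Dom C f" and ?B = "Cod C f" and ?D = "Cod C g"
  have "REval C ?A \<cdot> (\<one> ?A \<odot> (RDualA C f \<cdot> RDualA C g)) = (REval C ?B \<cdot> (\<one> ?B \<odot> RDualA C g)) \<cdot> (f \<odot> \<one> (RDual C ?D))"
    using assms by (simp add: REval_RDualA(2))
  also have "\<dots> = REval C ?D \<cdot> ((g \<cdot> f) \<odot> \<one> (RDual C ?D))"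
    unfolding REval_RDualA(1) [OF assms(2,3) refl] using assms by simp
  finally show "REval C (Dom C (g \<cdot> f)) \<cdot> (\<one> (Dom C (g \<cdot> f)) \<odot> (RDualA C f \<cdot> RDualA C g)) =
      REval C (Cod C (g \<cdot> f)) \<cdot> ((g \<cdot> f) \<odot> \<one> (RDual C (Cod C (g \<cdot> f))))"
    using assms by simp
qed (use assms in simp_all)

lemma LDualA_Comp [simp]:
  assumes "f \<in> Arr C" "g \<in> Arr C" "Dom C g = Cod C f"
  shows "LDualA C (g \<cdot> f) = LDualA C f \<cdot> LDualA C g"
proof (rule LDualA_eqI)
  let ?A = "Dom C f" and ?B = "Cod C f" and ?D = "Cod C g"
  have "LEval C ?A \<cdot> ((LDualA C f \<cdot> LDualA C g) \<odot> \<one> ?A) = (LEval C ?B \<cdot> (LDualA C g \<odot> \<one> ?B)) \<cdot> (\<one> (LDual C ?D) \<odot> f)"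
    using assms by (simp add: LEval_LDualA(2))
  also have "\<dots> = LEval C ?D \<cdot> (\<one> (LDual C ?D) \<odot> (g \<cdot> f))"
    unfolding LEval_LDualA(1) [OF assms(2,3) refl] using assms by simp
  finally show "LEval C (Dom C (g \<cdot> f)) \<cdot> ((LDualA C f \<cdot> LDualA C g) \<odot> \<one> (Dom C (g \<cdot> f))) =
      LEval C (Cod C (g \<cdot> f)) \<cdot> (\<one> (LDual C (Cod C (g \<cdot> f))) \<odot> (g \<cdot> f))"
    using assms by simp
qed (use assms in simp_all)

lemma LDualA_iso [simp]:
  assumes "iso C f"
  shows "iso C (LDualA C f)" "LDualA C (inv f) = inv (LDualA C f)"
proof -
  have "inverse_arrows C (LDualA C f) (LDualA C (inv f))"
    unfolding inverse_arrows_def using assms by (simp flip: LDualA_Comp)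
  then show "iso C (LDualA C f)" "LDualA C (inv f) = inv (LDualA C f)"
    using inv_eqI by auto
qed

lemma RDualA_iso [simp]:
  assumes "iso C f"
  shows "iso C (RDualA C f)" "RDualA C (inv f) = inv (RDualA C f)"
proof -
  have "inverse_arrows C (RDualA C f) (RDualA C (inv f))"
    unfolding inverse_arrows_def using assms by (simp flip: RDualA_Comp)
  then show "iso C (RDualA C f)" "RDualA C (inv f) = inv (RDualA C f)"
    using inv_eqI by auto
qed

lemma RLunit_arr [simp]:
  assumes "A \<in> Obj C"
  shows "Dom C (RLunit C A) = A" "Cod C (RLunit C A) = RDual C (LDual C A)"
    "REval C (LDual C A) \<cdot> (\<one> (LDual C A) \<odot> RLunit C A) = LEval C A"
  using assms unfolding RLunit_def by (simp_all add: RUncur_arr)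

lemma LRunit_arr [simp]:
  assumes "A \<in> Obj C"
  shows "Dom C (LRunit C A) = A" "Cod C (LRunit C A) = LDual C (RDual C A)"
    "LEval C (RDual C A) \<cdot> (LRunit C A \<odot> \<one> (RDual C A)) = REval C A"
  using assms unfolding LRunit_def by (simp_all add: LUncur_arr)

text \<open>
  Evaluating either side turns the canonical map into the other evaluation, so that naturality is the
  dinaturality of \<open>LEval\<close>.
\<close>

lemma RLunit_nat:
  assumes "f \<in> Arr C" "Dom C f = A" "Cod C f = B"
  shows "RDualA C (LDualA C f) \<cdot> RLunit C A = RLunit C B \<cdot> f"
proof (rule REval_inject [of "LDual C B"])
  have AB: "A \<in> Obj C" "B \<in> Obj C" using assms by auto
  let ?LA = "LDual C A" and ?LB = "LDual C B"
  have "REval C ?LB \<cdot> (\<one> ?LB \<odot> (RDualA C (LDualA C f) \<cdot> RLunit C A)) =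
      (REval C ?LA \<cdot> (\<one> ?LA \<odot> RLunit C A)) \<cdot> (LDualA C f \<odot> \<one> A)"
    using assms AB by (simp add: REval_RDualA(2) del: RLunit_arr(3))
  also have "\<dots> = (REval C ?LB \<cdot> (\<one> ?LB \<odot> RLunit C B)) \<cdot> (\<one> ?LB \<odot> f)"
    using assms AB by (simp add: LEval_LDualA(1))
  also have "\<dots> = REval C ?LB \<cdot> (\<one> ?LB \<odot> (RLunit C B \<cdot> f))"
    using assms AB by (simp del: RLunit_arr(3))
  finally show "REval C ?LB \<cdot> (\<one> ?LB \<odot> (RDualA C (LDualA C f) \<cdot> RLunit C A)) =
      REval C ?LB \<cdot> (\<one> ?LB \<odot> (RLunit C B \<cdot> f))" .
qed (use assms in auto)

lemma LRunit_nat: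
  assumes "f \<in> Arr C" "Dom C f = A" "Cod C f = B"
  shows "LDualA C (RDualA C f) \<cdot> LRunit C A = LRunit C B \<cdot> f"
proof (rule LEval_inject [of "RDual C B"])
  have AB: "A \<in> Obj C" "B \<in> Obj C" using assms by auto
  let ?RA = "RDual C A" and ?RB = "RDual C B"
  have "LEval C ?RB \<cdot> ((LDualA C (RDualA C f) \<cdot> LRunit C A) \<odot> \<one> ?RB) =
      (LEval C ?RA \<cdot> (LRunit C A \<odot> \<one> ?RA)) \<cdot> (\<one> A \<odot> RDualA C f)"
    using assms AB by (simp add: LEval_LDualA(2) del: LRunit_arr(3))
  also have "\<dots> = (LEval C ?RB \<cdot> (LRunit C B \<odot> \<one> ?RB)) \<cdot> (f \<odot> \<one> ?RB)"
    using assms AB by (simp add: REval_RDualA(1))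
  also have "\<dots> = LEval C ?RB \<cdot> ((LRunit C B \<cdot> f) \<odot> \<one> ?RB)"
    using assms AB by (simp del: LRunit_arr(3))
  finally show "LEval C ?RB \<cdot> ((LDualA C (RDualA C f) \<cdot> LRunit C A) \<odot> \<one> ?RB) =
      LEval C ?RB \<cdot> ((LRunit C B \<cdot> f) \<odot> \<one> ?RB)" .
qed (use assms in auto)

text \<open>
  The canonical maps are the units of the contravariant adjunction between the two duals, and these are its
  triangle identities. They express the inverses of the canonical maps at duals, which occur in the
  unitors of the dual tensor product.
\<close>

lemma RL_triangle:
  assumes "A \<in> Obj C"
  shows "RDualA C (LRunit C A) \<cdot> RLunit C (RDual C A) = \<one> (RDual C A)"
proof (rule REval_inject [of A])
  let ?R = "RDual C A"
  have "REval C A \<cdot> (\<one> A \<odot> (RDualA C (LRunit C A) \<cdot> RLunit C ?R)) =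
      (REval C (LDual C ?R) \<cdot> (\<one> (LDual C ?R) \<odot> RLunit C ?R)) \<cdot> (LRunit C A \<odot> \<one> ?R)"
    using assms by (simp add: REval_RDualA(2) del: RLunit_arr(3))
  also have "\<dots> = REval C A \<cdot> (\<one> A \<odot> \<one> ?R)"
    using assms by simp
  finally show "REval C A \<cdot> (\<one> A \<odot> (RDualA C (LRunit C A) \<cdot> RLunit C ?R)) = REval C A \<cdot> (\<one> A \<odot> \<one> ?R)" .
qed (use assms in simp_all)

lemma LR_triangle:
  assumes "A \<in> Obj C"
  shows "LDualA C (RLunit C A) \<cdot> LRunit C (LDual C A) = \<one> (LDual C A)"
proof (rule LEval_inject [of A])
  let ?L = "LDual C A"
  have "LEval C A \<cdot> ((LDualA C (RLunit C A) \<cdot> LRunit C ?L) \<odot> \<one> A) =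
      (LEval C (RDual C ?L) \<cdot> (LRunit C ?L \<odot> \<one> (RDual C ?L))) \<cdot> (\<one> ?L \<odot> RLunit C A)"
    using assms by (simp add: LEval_LDualA(2) del: LRunit_arr(3))
  also have "\<dots> = LEval C A \<cdot> (\<one> ?L \<odot> \<one> A)"
    using assms by simp
  finally show "LEval C A \<cdot> ((LDualA C (RLunit C A) \<cdot> LRunit C ?L) \<odot> \<one> A) = LEval C A \<cdot> (\<one> ?L \<odot> \<one> A)" .
qed (use assms in simp_all)

text \<open>Naturality of the canonical isomorphism recovers \<open>f\<close> from its double dual.\<close>

lemma LDualA_inject:
  assumes "LDualA C f = LDualA C g" "f \<in> hom C A B" "g \<in> hom C A B"
  shows "f = g"
proof (rule iso_cancel_left [of "RLunit C B"])
  show "RLunit C B \<cdot> f = RLunit C B \<cdot> g"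
    using RLunit_nat [of f A B] RLunit_nat [of g A B] assms by simp
qed (use assms in auto)

lemma RDualA_inject:
  assumes "RDualA C f = RDualA C g" "f \<in> hom C A B" "g \<in> hom C A B"
  shows "f = g"
proof (rule iso_cancel_left [of "LRunit C B"])
  show "LRunit C B \<cdot> f = LRunit C B \<cdot> g"
    using LRunit_nat [of f A B] LRunit_nat [of g A B] assms by simp
qed (use assms in auto)

text \<open>
  This is fullness, with an explicit preimage of \<open>h\<close>; the same expressions occur in \<open>left_of_right_trace\<close> and
  \<open>right_of_left_trace\<close>. Naturality of the canonical map gives the equation after applying the other dual,
  which is faithful.
\<close>

lemma RDualA_conj_LDualA:
  assumes "A \<in> Obj C" "B \<in> Obj C" "h \<in> hom C (RDual C B) (RDual C A)"
  shows "RDualA C (inv (LRunit C B) \<cdot> LDualA C h \<cdot> LRunit C A) = h" (is "RDualA C ?f = h")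
proof (rule LDualA_inject)
  have f: "?f \<in> hom C A B" using assms by simp
  have "LDualA C (RDualA C ?f) \<cdot> LRunit C A = LDualA C h \<cdot> LRunit C A"
    using LRunit_nat [of ?f A B] f assms by simp
  then show "LDualA C (RDualA C ?f) = LDualA C h"
    by (rule iso_cancel_right [rotated -1]) (use f assms in simp_all)
  show "RDualA C ?f \<in> hom C (RDual C B) (RDual C A)" using f by simp
qed (use assms in simp)

lemma LDualA_conj_RDualA:
  assumes "A \<in> Obj C" "B \<in> Obj C" "h \<in> hom C (LDual C B) (LDual C A)"
  shows "LDualA C (inv (RLunit C B) \<cdot> RDualA C h \<cdot> RLunit C A) = h" (is "LDualA C ?f = h")
proof (rule RDualA_inject)
  have f: "?f \<in> hom C A B" using assms by simp
  have "RDualA C (LDualA C ?f) \<cdot> RLunit C A = RDualA C h \<cdot> RLunit C A"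
    using RLunit_nat [of ?f A B] f assms by simp
  then show "RDualA C (LDualA C ?f) = RDualA C h"
    by (rule iso_cancel_right [rotated -1]) (use f assms in simp_all)
  show "LDualA C ?f \<in> hom C (LDual C B) (LDual C A)" using f by simp
qed (use assms in simp)

lemma RDualA_embedding: "contravariant_embedding C C (RDual C) (RDualA C)"
proof unfold_locales
  fix A B assume AB: "A \<in> Obj C" "B \<in> Obj C"
  show "bij_betw (RDualA C) (hom C A B) (hom C (RDual C B) (RDual C A))"
  proof (rule bij_betw_imageI)
    show "inj_on (RDualA C) (hom C A B)"
      by (rule inj_onI) (rule RDualA_inject)
    have "h \<in> RDualA C ` hom C A B" if h: "h \<in> hom C (RDual C B) (RDual C A)" for h
      using RDualA_conj_LDualA [OF AB h, symmetric] by (rule image_eqI) (use AB h in simp)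
    then show "RDualA C ` hom C A B = hom C (RDual C B) (RDual C A)" by auto
  qed
qed auto

lemma LDualA_embedding: "contravariant_embedding C C (LDual C) (LDualA C)"
proof unfold_locales
  fix A B assume AB: "A \<in> Obj C" "B \<in> Obj C"
  show "bij_betw (LDualA C) (hom C A B) (hom C (LDual C B) (LDual C A))"
  proof (rule bij_betw_imageI)
    show "inj_on (LDualA C) (hom C A B)"
      by (rule inj_onI) (rule LDualA_inject)
    have "h \<in> LDualA C ` hom C A B" if h: "h \<in> hom C (LDual C B) (LDual C A)" for h
      using LDualA_conj_RDualA [OF AB h, symmetric] by (rule image_eqI) (use AB h in simp)
    then show "LDualA C ` hom C A B = hom C (LDual C B) (LDual C A)" by auto
  qed
qed auto

text \<open>
  The unit comparison for \<open>LDual\<close>. It is an isomorphism because \<open>LDual I\<close> represents the maps into \<open>\<bottom>\<close> from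
  \<open>X \<otimes> I\<close>, that is, from \<open>X\<close>. Maps from \<open>X\<close> into \<open>RDual \<bottom>\<close>, in contrast, correspond to
  maps \<open>\<bottom> \<otimes> X \<rightarrow> \<bottom>\<close>; \<open>unit_to_RDual_Bot\<close> is an isomorphism because it is, up to \<open>RLunit\<close>, the dual of this
  map.
\<close>

definition Bot_to_LDual_Unit :: 'm
  where "Bot_to_LDual_Unit = LUncur C (Unit C) (Bot C) (RUnit C (Bot C))"

lemma Bot_to_LDual_Unit_iso:
  "Bot_to_LDual_Unit \<in> hom C (Bot C) (LDual C (Unit C))" "iso C Bot_to_LDual_Unit"
proof -
  let ?I = "Unit C" and ?w = "Bot_to_LDual_Unit"
  let ?v = "LEval C ?I \<cdot> inv (RUnit C (LDual C ?I))"
  have w: "?w \<in> Arr C" "Dom C ?w = Bot C" "Cod C ?w = LDual C ?I"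
      "LEval C ?I \<cdot> (?w \<odot> \<one> ?I) = RUnit C (Bot C)"
    unfolding Bot_to_LDual_Unit_def by (simp_all add: LUncur_arr)
  then show "?w \<in> hom C (Bot C) (LDual C ?I)" by simp
  have vnat: "?v \<cdot> RUnit C (LDual C ?I) = RUnit C (Bot C) \<cdot> (?v \<odot> \<one> ?I)"
    by (rule RUnit_nat [symmetric]) simp
  have "RUnit C (LDual C ?I) \<cdot> (?w \<odot> \<one> ?I) = ?w \<cdot> RUnit C (Bot C)"
    by (rule RUnit_nat) (use w in simp)
  then have wnat: "inv (RUnit C (LDual C ?I)) \<cdot> ?w = (?w \<odot> \<one> ?I) \<cdot> inv (RUnit C (Bot C))"
    by (intro inv_square) (use w in simp_all)
  have "?v \<cdot> ?w = (LEval C ?I \<cdot> (?w \<odot> \<one> ?I)) \<cdot> inv (RUnit C (Bot C))"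
    using w(1-3) wnat by simp
  also have "\<dots> = \<one> (Bot C)"
    unfolding w(4) by simp
  finally have vw: "?v \<cdot> ?w = \<one> (Bot C)" .
  have wv: "?w \<cdot> ?v = \<one> (LDual C ?I)"
  proof (rule LEval_inject [of ?I])
    have "LEval C ?I \<cdot> ((?w \<cdot> ?v) \<odot> \<one> ?I) = (LEval C ?I \<cdot> (?w \<odot> \<one> ?I)) \<cdot> (?v \<odot> \<one> ?I)"
      using w(1-3) by simp
    also have "\<dots> = ?v \<cdot> RUnit C (LDual C ?I)"
      unfolding w(4) by (rule vnat [symmetric])
    also have "\<dots> = LEval C ?I \<cdot> (\<one> (LDual C ?I) \<odot> \<one> ?I)"
      by simp
    finally show "LEval C ?I \<cdot> ((?w \<cdot> ?v) \<odot> \<one> ?I) = LEval C ?I \<cdot> (\<one> (LDual C ?I) \<odot> \<one> ?I)" .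
  qed (use w in simp_all)
  have "inverse_arrows C ?w ?v"
    unfolding inverse_arrows_def using w vw wv by simp
  then show "iso C ?w" by (rule inv_eqI)
qed

lemma unit_to_RDual_Bot_eq:
  "unit_to_RDual_Bot C = RDualA C Bot_to_LDual_Unit \<cdot> RLunit C (Unit C)"
proof -
  let ?I = "Unit C" and ?w = "Bot_to_LDual_Unit" and ?u = "unit_to_RDual_Bot C"
  note w = Bot_to_LDual_Unit_iso
  have u: "?u \<in> Arr C" "Dom C ?u = ?I" "Cod C ?u = RDual C (Bot C)"
      "REval C (Bot C) \<cdot> (\<one> (Bot C) \<odot> ?u) = RUnit C (Bot C)"
    unfolding unit_to_RDual_Bot_def by (simp_all add: RUncur_arr)
  show ?thesis
  proof (rule REval_inject [of "Bot C"])
    have "REval C (Bot C) \<cdot> (\<one> (Bot C) \<odot> (RDualA C ?w \<cdot> RLunit C ?I)) =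
        (REval C (LDual C ?I) \<cdot> (\<one> (LDual C ?I) \<odot> RLunit C ?I)) \<cdot> (?w \<odot> \<one> ?I)"
      using w by (simp add: REval_RDualA(2) del: RLunit_arr(3))
    also have "\<dots> = RUnit C (Bot C)"
      unfolding Bot_to_LDual_Unit_def by (simp add: LUncur_arr)
    finally show "REval C (Bot C) \<cdot> (\<one> (Bot C) \<odot> ?u) =
        REval C (Bot C) \<cdot> (\<one> (Bot C) \<odot> (RDualA C ?w \<cdot> RLunit C ?I))"
      using u by simp
  qed (use u w in simp_all)
qed

end

section \<open>The duals as monoidal embeddings for the dual tensor product\<close>

context star_autonomous_category
begin

text \<open>Right traces for this product are the left traces for the dual tensor product.\<close>

abbreviation revpar :: "('o, 'm) monoidal_data"
  where "revpar \<equiv> rev_monoidal (par C)"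

lemma inverse_arrows_revpar: "inverse_arrows revpar = inverse_arrows C" "inverse_arrows (par C) = inverse_arrows C"
  by (simp_all add: fun_eq_iff inverse_arrows_def rev_monoidal_def par_def)

lemma revpar_simps [simp]:
  "Obj revpar = Obj C" "Arr revpar = Arr C" "Dom revpar = Dom C" "Cod revpar = Cod C"
  "Idn revpar = Idn C" "Comp revpar = Comp C" "Unit revpar = Bot C"
  "A \<otimes>\<^bsub>revpar\<^esub> B = LDual C (RDual C A \<otimes> RDual C B)"
  "f \<odot>\<^bsub>revpar\<^esub> g = LDualA C (RDualA C f \<odot> RDualA C g)"
  "iso revpar f = iso C f" "inv\<^bsub>revpar\<^esub> f = inv f"
  by (simp_all add: iso_def arr_inv_def inverse_arrows_revpar) (simp_all add: rev_monoidal_def par_def)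

lemma hom_revpar [simp]: "hom revpar = hom C"
  by (simp add: fun_eq_iff set_eq_iff)

lemma par_TenO [simp]: "A \<otimes>\<^bsub>par C\<^esub> B = LDual C (RDual C B \<otimes> RDual C A)"
  unfolding par_def by simp

lemma revpar_structure:
  "Assoc revpar A B D = inv (LDualA C ((\<one> (RDual C A) \<odot> RLunit C (RDual C B \<otimes> RDual C D)) \<cdot>
    Assoc C (RDual C A) (RDual C B) (RDual C D) \<cdot> (inv (RLunit C (RDual C A \<otimes> RDual C B)) \<odot> \<one> (RDual C D))))"
  "LUnit revpar A = inv (LRunit C A) \<cdot>
    LDualA C ((unit_to_RDual_Bot C \<odot> \<one> (RDual C A)) \<cdot> inv (LUnit C (RDual C A)))"
  "RUnit revpar A = inv (LRunit C A) \<cdot>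
    LDualA C ((\<one> (RDual C A) \<odot> unit_to_RDual_Bot C) \<cdot> inv (RUnit C (RDual C A)))"
  by (simp_all add: arr_inv_def inverse_arrows_revpar rev_monoidal_def)
    (simp_all add: arr_inv_def inverse_arrows_revpar par_def)

lemma category_revpar: "category revpar"
  by unfold_locales auto

lemma unit_to_RDual_Bot_arr [simp]:
  "iso C (unit_to_RDual_Bot C)"
  "Dom C (unit_to_RDual_Bot C) = Unit C" "Cod C (unit_to_RDual_Bot C) = RDual C (Bot C)"
  using Bot_to_LDual_Unit_iso(1,2) by (simp_all add: unit_to_RDual_Bot_eq)

lemma inv_RDualA_LRunit:
  assumes "A \<in> Obj C"
  shows "inv (RDualA C (LRunit C A)) = RLunit C (RDual C A)"
  by (rule iso_cancel_left [of "RDualA C (LRunit C A)"]) (use assms RL_triangle in simp_all)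

lemma inv_LRunit_LDual:
  assumes "A \<in> Obj C"
  shows "inv (LRunit C (LDual C A)) = LDualA C (RLunit C A)"
  by (rule iso_cancel_right [of "LRunit C (LDual C A)"]) (use assms LR_triangle in simp_all)

lemma RDualA_LDualA:
  assumes "f \<in> Arr C"
  shows "RDualA C (LDualA C f) \<cdot> RLunit C (Dom C f) = RLunit C (Cod C f) \<cdot> f"
  by (rule RLunit_nat) (use assms in simp_all)

text \<open>
  The associator of the reversed dual tensor product is the inverse of the \<open>LDual\<close> of this map. The inverse
  comes from the reversal; together with the contravariance of \<open>LDual\<close> it makes \<open>dual_assoc\<close> run in the same
  direction as the associator of \<open>\<otimes>\<close>.
\<close>

definition dual_assoc :: "'o \<Rightarrow> 'o \<Rightarrow> 'o \<Rightarrow> 'm"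
  where "dual_assoc A B D = (\<one> (RDual C A) \<odot> RLunit C (RDual C B \<otimes> RDual C D)) \<cdot>
    Assoc C (RDual C A) (RDual C B) (RDual C D) \<cdot> (inv (RLunit C (RDual C A \<otimes> RDual C B)) \<odot> \<one> (RDual C D))"

lemma dual_assoc_arr [simp]:
  assumes "A \<in> Obj C" "B \<in> Obj C" "D \<in> Obj C"
  shows "iso C (dual_assoc A B D)"
    "Dom C (dual_assoc A B D) = RDual C (A \<otimes>\<^bsub>revpar\<^esub> B) \<otimes> RDual C D"
    "Cod C (dual_assoc A B D) = RDual C A \<otimes> RDual C (B \<otimes>\<^bsub>revpar\<^esub> D)"
  using assms by (simp_all add: dual_assoc_def)

lemma Assoc_revpar: "Assoc revpar A B D = inv (LDualA C (dual_assoc A B D))"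
  by (simp add: dual_assoc_def revpar_structure)

lemma dual_assoc_square:
  assumes "A \<in> Obj C" "B \<in> Obj C" "D \<in> Obj C"
  shows "dual_assoc A B D \<cdot> (RLunit C (RDual C A \<otimes> RDual C B) \<odot> \<one> (RDual C D)) =
    (\<one> (RDual C A) \<odot> RLunit C (RDual C B \<otimes> RDual C D)) \<cdot> Assoc C (RDual C A) (RDual C B) (RDual C D)"
  using assms by (simp add: dual_assoc_def)

lemma unitors_revpar_arr:
  assumes "A \<in> Obj C"
  shows "LUnit revpar A \<in> Arr C" "Dom C (LUnit revpar A) = Bot C \<otimes>\<^bsub>revpar\<^esub> A" "Cod C (LUnit revpar A) = A"
    "RUnit revpar A \<in> Arr C" "Dom C (RUnit revpar A) = A \<otimes>\<^bsub>revpar\<^esub> Bot C" "Cod C (RUnit revpar A) = A"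
  using assms by (simp_all add: revpar_structure)

text \<open>
  The comparison maps are instances of \<open>RLunit\<close>, and the structure of the dual tensor product consists of
  arrows of the form \<open>LDualA q\<close>, possibly followed by the inverse of \<open>LRunit\<close>. Hence each coherence condition
  is an instance of naturality of \<open>RLunit\<close>, which replaces \<open>RDualA (LDualA q)\<close> by \<open>q\<close>; for the unitors, a
  triangle identity first removes the inverse of \<open>LRunit\<close>.
\<close>

theorem RDual_monoidal_embedding:
  "contravariant_monoidal_embedding revpar C (RDual C) (RDualA C)
    (\<lambda>A B. RLunit C (RDual C A \<otimes> RDual C B)) (unit_to_RDual_Bot C)"
proof -
  interpret P: category revpar by (rule category_revpar)
  interpret R: contravariant_embedding C C "RDual C" "RDualA C" by (rule RDualA_embedding)
  interpret R': contravariant_embedding revpar C "RDual C" "RDualA C"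
    by unfold_locales (use R.Fa_bij in \<open>auto simp: hom_def\<close>)
  show ?thesis
  proof
    fix A B D assume asm: "A \<in> Obj revpar" "B \<in> Obj revpar" "D \<in> Obj revpar"
    then show "Assoc revpar A B D \<in> hom revpar ((A \<otimes>\<^bsub>revpar\<^esub> B) \<otimes>\<^bsub>revpar\<^esub> D) (A \<otimes>\<^bsub>revpar\<^esub> (B \<otimes>\<^bsub>revpar\<^esub> D))"
      by (simp add: Assoc_revpar)
    let ?K = "dual_assoc A B D"
    let ?phi = "\<lambda>A B. RLunit C (RDual C A \<otimes> RDual C B)"
    have "RDualA C (Assoc revpar A B D) \<cdot> ?phi A (B \<otimes>\<^bsub>revpar\<^esub> D) \<cdot>
        ((\<one> (RDual C A) \<odot> ?phi B D) \<cdot> Assoc C (RDual C A) (RDual C B) (RDual C D)) =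
        inv (RDualA C (LDualA C ?K)) \<cdot> (?phi A (B \<otimes>\<^bsub>revpar\<^esub> D) \<cdot> ?K) \<cdot> (?phi A B \<odot> \<one> (RDual C D))"
      using asm by (simp add: Assoc_revpar flip: dual_assoc_square)
    also have "\<dots> = ?phi (A \<otimes>\<^bsub>revpar\<^esub> B) D \<cdot> (?phi A B \<odot> \<one> (RDual C D))"
      using asm RDualA_LDualA [of ?K, symmetric] by simp
    finally show "RDualA C (Assoc revpar A B D) \<cdot> ?phi A (B \<otimes>\<^bsub>revpar\<^esub> D) \<cdot>
        (\<one> (RDual C A) \<odot> ?phi B D) \<cdot> Assoc C (RDual C A) (RDual C B) (RDual C D) =
        ?phi (A \<otimes>\<^bsub>revpar\<^esub> B) D \<cdot> (?phi A B \<odot> \<one> (RDual C D))" .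
  next
    fix A assume asm: "A \<in> Obj revpar"
    let ?u = "unit_to_RDual_Bot C" and ?R = "RDual C A"
    show "LUnit revpar A \<in> hom revpar (Unit revpar \<otimes>\<^bsub>revpar\<^esub> A) A"
      "RUnit revpar A \<in> hom revpar (A \<otimes>\<^bsub>revpar\<^esub> Unit revpar) A"
      using asm unitors_revpar_arr [of A] by simp_all
    define l where "l = (?u \<odot> \<one> ?R) \<cdot> inv (LUnit C ?R)"
    have l: "l \<in> Arr C" "Dom C l = ?R" "Cod C l = RDual C (Bot C) \<otimes> ?R" "l \<cdot> LUnit C ?R = ?u \<odot> \<one> ?R"
      using asm by (simp_all add: l_def)
    have "RDualA C (LUnit revpar A) \<cdot> LUnit C ?R = (RDualA C (LDualA C l) \<cdot> RLunit C ?R) \<cdot> LUnit C ?R"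
      unfolding revpar_structure l_def [symmetric] using asm l(1-3) by (simp add: inv_RDualA_LRunit)
    also have "\<dots> = RLunit C (RDual C (Bot C) \<otimes> ?R) \<cdot> (?u \<odot> \<one> ?R)"
      unfolding RLunit_nat [OF l(1-3)] using asm l by simp
    finally show "RDualA C (LUnit revpar A) \<cdot> LUnit C ?R = RLunit C (RDual C (Unit revpar) \<otimes> ?R) \<cdot> (?u \<odot> \<one> ?R)"
      by simp
    define r where "r = (\<one> ?R \<odot> ?u) \<cdot> inv (RUnit C ?R)"
    have r: "r \<in> Arr C" "Dom C r = ?R" "Cod C r = ?R \<otimes> RDual C (Bot C)" "r \<cdot> RUnit C ?R = \<one> ?R \<odot> ?u"
      using asm by (simp_all add: r_def)
    have "RDualA C (RUnit revpar A) \<cdot> RUnit C ?R = (RDualA C (LDualA C r) \<cdot> RLunit C ?R) \<cdot> RUnit C ?R"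
      unfolding revpar_structure r_def [symmetric] using asm r(1-3) by (simp add: inv_RDualA_LRunit)
    also have "\<dots> = RLunit C (?R \<otimes> RDual C (Bot C)) \<cdot> (\<one> ?R \<odot> ?u)"
      unfolding RLunit_nat [OF r(1-3)] using asm r by simp
    finally show "RDualA C (RUnit revpar A) \<cdot> RUnit C ?R = RLunit C (?R \<otimes> RDual C (Unit revpar)) \<cdot> (\<one> ?R \<odot> ?u)"
      by simp
  next
    fix f A A' g B B'
    assume "f \<in> hom revpar A A'" "g \<in> hom revpar B B'"
    then show "RDualA C (f \<odot>\<^bsub>revpar\<^esub> g) \<cdot> RLunit C (RDual C A' \<otimes> RDual C B') =
        RLunit C (RDual C A \<otimes> RDual C B) \<cdot> (RDualA C f \<odot> RDualA C g)"
      using RDualA_LDualA [of "RDualA C f \<odot> RDualA C g"] by auto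
  qed auto
qed

text \<open>
  Here everything lies in the image of \<open>LDualA\<close>, so that each condition is \<open>LDualA\<close> of an equation in \<open>\<otimes>\<close>. That
  equation is the naturality of an associator or unitor of \<open>\<otimes>\<close> at the canonical maps \<open>RLunit\<close>.
\<close>

theorem LDual_monoidal_embedding:
  "contravariant_monoidal_embedding C revpar (LDual C) (LDualA C)
    (\<lambda>A B. LDualA C (RLunit C A \<odot> RLunit C B)) Bot_to_LDual_Unit"
proof -
  interpret R: contravariant_monoidal_embedding revpar C "RDual C" "RDualA C"
    "\<lambda>A B. RLunit C (RDual C A \<otimes> RDual C B)" "unit_to_RDual_Bot C"
    by (rule RDual_monoidal_embedding)
  interpret P: monoidal_category revpar by (rule R.M_monoidal)
  interpret L: contravariant_embedding C C "LDual C" "LDualA C" by (rule LDualA_embedding)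
  interpret L': contravariant_embedding C revpar "LDual C" "LDualA C"
    by unfold_locales (use L.Fa_bij in \<open>auto simp: hom_def\<close>)
  let ?psi = "\<lambda>A B. LDualA C (RLunit C A \<odot> RLunit C B)"
  have RDualA_psi: "RDualA C (?psi A B) \<cdot> RLunit C (A \<otimes> B) =
      RLunit C (RDual C (LDual C A) \<otimes> RDual C (LDual C B)) \<cdot> (RLunit C A \<odot> RLunit C B)"
    if "A \<in> Obj C" "B \<in> Obj C" for A B
    using that RDualA_LDualA [of "RLunit C A \<odot> RLunit C B"] by simp
  show ?thesis
  proof
    fix f A A' g B B'
    assume asm: "f \<in> hom C A A'" "g \<in> hom C B B'"
    then have "A \<in> Obj C" "A' \<in> Obj C" "B \<in> Obj C" "B' \<in> Obj C" by auto
    then show "LDualA C (f \<odot> g) \<cdot>\<^bsub>revpar\<^esub> ?psi A' B' = ?psi A B \<cdot>\<^bsub>revpar\<^esub> (LDualA C f \<odot>\<^bsub>revpar\<^esub> LDualA C g)"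
      using asm RDualA_LDualA [of f] RDualA_LDualA [of g] by (simp flip: LDualA_Comp)
  next
    fix A B D assume asm: "A \<in> Obj C" "B \<in> Obj C" "D \<in> Obj C"
    let ?LA = "LDual C A" and ?LB = "LDual C B" and ?LD = "LDual C D"
    let ?K = "dual_assoc ?LA ?LB ?LD"
    let ?phi = "\<lambda>A B. RLunit C (RDual C A \<otimes> RDual C B)"
    let ?e = "RLunit C"
    let ?l = "(\<one> (RDual C ?LA) \<odot> RDualA C (?psi B D)) \<cdot> (?e A \<odot> ?e (B \<otimes> D)) \<cdot> Assoc C A B D"
    let ?r = "?K \<cdot> (RDualA C (?psi A B) \<odot> \<one> (RDual C ?LD)) \<cdot> (?e (A \<otimes> B) \<odot> ?e D)"
    have "?r = (?K \<cdot> (?phi ?LA ?LB \<odot> \<one> (RDual C ?LD))) \<cdot> ((?e A \<odot> ?e B) \<odot> ?e D)"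
      using asm by (simp add: RDualA_psi)
    also have "\<dots> = (\<one> (RDual C ?LA) \<odot> ?phi ?LB ?LD) \<cdot>
        (Assoc C (RDual C ?LA) (RDual C ?LB) (RDual C ?LD) \<cdot> ((?e A \<odot> ?e B) \<odot> ?e D))"
      unfolding dual_assoc_square [OF L.Fo_Obj L.Fo_Obj L.Fo_Obj, OF asm] using asm by simp
    also have "\<dots> = (\<one> (RDual C ?LA) \<odot> ?phi ?LB ?LD) \<cdot> ((?e A \<odot> (?e B \<odot> ?e D)) \<cdot> Assoc C A B D)"
      using asm Assoc_nat_arr [of "?e A" "?e B" "?e D"] by simp
    also have "\<dots> = ?l"
      using asm by (simp add: RDualA_psi)
    finally have "LDualA C ?l = LDualA C ?r" by simp
    then have eq: "LDualA C (Assoc C A B D) \<cdot> ?psi A (B \<otimes> D) \<cdot> (\<one> ?LA \<odot>\<^bsub>revpar\<^esub> ?psi B D) =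
        (?psi (A \<otimes> B) D \<cdot> (?psi A B \<odot>\<^bsub>revpar\<^esub> \<one> ?LD)) \<cdot> LDualA C ?K"
      using asm by (simp del: interchange)
    have "(LDualA C (Assoc C A B D) \<cdot> ?psi A (B \<otimes> D) \<cdot> (\<one> ?LA \<odot>\<^bsub>revpar\<^esub> ?psi B D)) \<cdot> Assoc revpar ?LA ?LB ?LD =
        ?psi (A \<otimes> B) D \<cdot> (?psi A B \<odot>\<^bsub>revpar\<^esub> \<one> ?LD)"
      unfolding eq Assoc_revpar using asm by simp
    then show "LDualA C (Assoc C A B D) \<cdot>\<^bsub>revpar\<^esub> ?psi A (B \<otimes> D) \<cdot>\<^bsub>revpar\<^esub> (\<one>\<^bsub>revpar\<^esub> ?LA \<odot>\<^bsub>revpar\<^esub> ?psi B D) \<cdot>\<^bsub>revpar\<^esub>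
        Assoc revpar ?LA ?LB ?LD = ?psi (A \<otimes> B) D \<cdot>\<^bsub>revpar\<^esub> (?psi A B \<odot>\<^bsub>revpar\<^esub> \<one>\<^bsub>revpar\<^esub> ?LD)"
      using asm by (simp add: Assoc_revpar)
  next
    fix A assume asm: "A \<in> Obj C"
    let ?u = "unit_to_RDual_Bot C" and ?w = Bot_to_LDual_Unit and ?e = "RLunit C" and ?L = "LDual C A"
    let ?R = "RDual C ?L"
    have w: "?w \<in> Arr C" "Dom C ?w = Bot C" "Cod C ?w = LDual C (Unit C)"
      using Bot_to_LDual_Unit_iso(1) by simp_all
    have "inv (LUnit C ?R) \<cdot> ?e A = (\<one> (Unit C) \<odot> ?e A) \<cdot> inv (LUnit C A)"
      by (rule inv_square) (use asm LUnit_nat [of "?e A" A ?R] in simp_all)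
    then have "(?u \<odot> \<one> ?R) \<cdot> inv (LUnit C ?R) \<cdot> ?e A \<cdot> LUnit C A = ?u \<odot> ?e A"
      using asm Comp_extend [of "inv (LUnit C ?R)" "?e A" _ "LUnit C A"] by simp
    then have "LDualA C ((?u \<odot> \<one> ?R) \<cdot> inv (LUnit C ?R) \<cdot> ?e A \<cdot> LUnit C A) =
        LDualA C ((RDualA C ?w \<odot> \<one> ?R) \<cdot> (?e (Unit C) \<odot> ?e A))"
      using asm w by (simp add: unit_to_RDual_Bot_eq)
    then show "LDualA C (LUnit C A) \<cdot>\<^bsub>revpar\<^esub> LUnit revpar ?L =
        ?psi (Unit C) A \<cdot>\<^bsub>revpar\<^esub> (?w \<odot>\<^bsub>revpar\<^esub> \<one>\<^bsub>revpar\<^esub> ?L)"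
      using asm w by (simp add: revpar_structure inv_LRunit_LDual del: interchange)
    have "inv (RUnit C ?R) \<cdot> ?e A = (?e A \<odot> \<one> (Unit C)) \<cdot> inv (RUnit C A)"
      by (rule inv_square) (use asm RUnit_nat [of "?e A" A ?R] in simp_all)
    then have "(\<one> ?R \<odot> ?u) \<cdot> inv (RUnit C ?R) \<cdot> ?e A \<cdot> RUnit C A = ?e A \<odot> ?u"
      using asm Comp_extend [of "inv (RUnit C ?R)" "?e A" _ "RUnit C A"] by simp
    then have "LDualA C ((\<one> ?R \<odot> ?u) \<cdot> inv (RUnit C ?R) \<cdot> ?e A \<cdot> RUnit C A) =
        LDualA C ((\<one> ?R \<odot> RDualA C ?w) \<cdot> (?e A \<odot> ?e (Unit C)))"
      using asm w by (simp add: unit_to_RDual_Bot_eq)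
    then show "LDualA C (RUnit C A) \<cdot>\<^bsub>revpar\<^esub> RUnit revpar ?L =
        ?psi A (Unit C) \<cdot>\<^bsub>revpar\<^esub> (\<one>\<^bsub>revpar\<^esub> ?L \<odot>\<^bsub>revpar\<^esub> ?w)"
      using asm w by (simp add: revpar_structure inv_LRunit_LDual del: interchange)
  qed (use Bot_to_LDual_Unit_iso in auto)
qed

end

section \<open>Transport of traces through the duality\<close>

context star_autonomous_category
begin

interpretation R: contravariant_monoidal_embedding revpar C "RDual C" "RDualA C"
    "\<lambda>A B. RLunit C (RDual C A \<otimes> RDual C B)" "unit_to_RDual_Bot C"
  by (rule RDual_monoidal_embedding)

interpretation L: contravariant_monoidal_embedding C revpar "LDual C" "LDualA C"
    "\<lambda>A B. LDualA C (RLunit C A \<odot> RLunit C B)" Bot_to_LDual_Unit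
  by (rule LDual_monoidal_embedding)

text \<open>
  In both definitions, the arrow handed to the given trace is the conjugate of a dual by the comparison maps
  of the respective embedding, and the surrounding canonical maps take the preimage of the result.
\<close>

lemma left_of_right_trace_pulled_back:
  assumes Tr: "Tr \<in> trace_families C"
  shows "R.pulled_back_trace Tr (left_of_right_trace C Tr)"
proof -
  let ?T = "left_of_right_trace C Tr"
  have *: "?T X A B f \<in> hom C A B"
      "RDualA C (?T X A B f) = Tr (RDual C X) (RDual C B) (RDual C A)
        (inv (RLunit C (RDual C A \<otimes> RDual C X)) \<cdot> RDualA C f \<cdot> RLunit C (RDual C B \<otimes> RDual C X))"
      (is "_ = ?h")
    if asm: "X \<in> Obj C" "A \<in> Obj C" "B \<in> Obj C" "f \<in> hom C (A \<otimes>\<^bsub>revpar\<^esub> X) (B \<otimes>\<^bsub>revpar\<^esub> X)" for X A B f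
  proof -
    have h: "?h \<in> hom C (RDual C B) (RDual C A)"
      using asm by (intro trace_families_apply [OF Tr]) simp_all
    have T: "?T X A B f = inv (LRunit C B) \<cdot> LDualA C ?h \<cdot> LRunit C A"
      using asm by (simp add: left_of_right_trace_def)
    show "?T X A B f \<in> hom C A B"
      unfolding T using asm(1-3) h by simp
    show "RDualA C (?T X A B f) = ?h"
      unfolding T using asm(2,3) h by (rule RDualA_conj_LDualA)
  qed
  have "?T \<in> trace_families revpar"
    unfolding trace_families_def hom_revpar
    using *(1) unfolding left_of_right_trace_def by (auto simp del: in_hom)
  then show ?thesis
    unfolding R.pulled_back_trace_def using *(2) by simp
qed

lemma right_of_left_trace_pulled_back:
  assumes T: "T \<in> trace_families revpar"
  shows "L.pulled_back_trace T (right_of_left_trace C T)"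
proof -
  let ?S = "right_of_left_trace C T"
  let ?psi = "\<lambda>A B. LDualA C (RLunit C A \<odot> RLunit C B)"
  have *: "?S X A B f \<in> hom C A B"
      "LDualA C (?S X A B f) = T (LDual C X) (LDual C B) (LDual C A) (inv (?psi A X) \<cdot> LDualA C f \<cdot> ?psi B X)"
      (is "_ = ?h")
    if asm: "X \<in> Obj C" "A \<in> Obj C" "B \<in> Obj C" "f \<in> hom C (A \<otimes> X) (B \<otimes> X)" for X A B f
  proof -
    have h: "?h \<in> hom C (LDual C B) (LDual C A)"
      using asm by (intro trace_families_apply [OF T, unfolded hom_revpar]) simp_all
    have S: "?S X A B f = inv (RLunit C B) \<cdot> RDualA C ?h \<cdot> RLunit C A"
      using asm by (simp add: right_of_left_trace_def)
    show "?S X A B f \<in> hom C A B"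
      unfolding S using asm(1-3) h by simp
    show "LDualA C (?S X A B f) = ?h"
      unfolding S using asm(2,3) h by (rule LDualA_conj_RDualA)
  qed
  have "?S \<in> trace_families C"
    unfolding trace_families_def
    using *(1) unfolding right_of_left_trace_def by (auto simp del: in_hom)
  then show ?thesis
    unfolding L.pulled_back_trace_def using *(2) by simp
qed

lemma right_trace_left_of_right:
  assumes "right_trace C Tr"
  shows "right_trace revpar (left_of_right_trace C Tr)"
  using R.right_trace_pulled_back left_of_right_trace_pulled_back assms right_trace.family by blast

lemma right_trace_right_of_left:
  assumes "right_trace revpar T"
  shows "right_trace C (right_of_left_trace C T)"
  using L.right_trace_pulled_back right_of_left_trace_pulled_back assms right_trace.family by blast

text \<open>
  The monoidality of \<open>RLunit\<close>, required of \<open>eps\<close>, is its naturality at \<open>RLunit A \<odot> RLunit B\<close>.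
\<close>

lemma right_left_right:
  assumes "right_trace C Tr"
  shows "right_of_left_trace C (left_of_right_trace C Tr) = Tr"
proof (rule pulled_back_trace_inverse [OF RDual_monoidal_embedding LDual_monoidal_embedding, of "RLunit C"])
  show "RDualA C (LDualA C (RLunit C A \<odot> RLunit C B)) \<cdot> RLunit C (A \<otimes> B) =
      RLunit C (RDual C (LDual C A) \<otimes> RDual C (LDual C B)) \<cdot> (RLunit C A \<odot> RLunit C B)"
    if "A \<in> Obj C" "B \<in> Obj C" for A B
    using that by (intro RLunit_nat) simp_all
  show "right_trace C Tr" by fact
  show "R.pulled_back_trace Tr (left_of_right_trace C Tr)"
    using assms by (intro left_of_right_trace_pulled_back right_trace.family)
  show "L.pulled_back_trace (left_of_right_trace C Tr) (right_of_left_trace C (left_of_right_trace C Tr))"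
    using assms by (intro right_of_left_trace_pulled_back right_trace.family right_trace_left_of_right)
qed (auto intro: RLunit_nat)

text \<open>
  In the other direction, both sides of the monoidality of \<open>LRunit\<close> are identities, each by one of the
  triangle identities.
\<close>

lemma left_right_left:
  assumes "right_trace revpar T"
  shows "left_of_right_trace C (right_of_left_trace C T) = T"
proof (rule pulled_back_trace_inverse [OF LDual_monoidal_embedding RDual_monoidal_embedding, of "LRunit C"])
  fix A B assume "A \<in> Obj revpar" "B \<in> Obj revpar"
  then have AB: "A \<in> Obj C" "B \<in> Obj C" by simp_all
  let ?RA = "RDual C A" and ?RB = "RDual C B"
  have "(RDualA C (LRunit C A) \<odot> RDualA C (LRunit C B)) \<cdot> (RLunit C ?RA \<odot> RLunit C ?RB) = \<one> (?RA \<otimes> ?RB)"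
    using AB by (simp add: RL_triangle)
  then have "LDualA C (RLunit C ?RA \<odot> RLunit C ?RB) \<cdot> LDualA C (RDualA C (LRunit C A) \<odot> RDualA C (LRunit C B)) =
      \<one> (A \<otimes>\<^bsub>revpar\<^esub> B)"
    using AB by (simp del: interchange flip: LDualA_Comp)
  then show "LDualA C (RLunit C (?RA \<otimes> ?RB)) \<cdot>\<^bsub>revpar\<^esub> LRunit C (A \<otimes>\<^bsub>revpar\<^esub> B) =
      LDualA C (RLunit C ?RA \<odot> RLunit C ?RB) \<cdot>\<^bsub>revpar\<^esub> (LRunit C A \<odot>\<^bsub>revpar\<^esub> LRunit C B)"
    using AB LR_triangle [of "?RA \<otimes> ?RB"] by simp
next
  show "right_trace revpar T" by fact
  show "L.pulled_back_trace T (right_of_left_trace C T)"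
    using assms by (intro right_of_left_trace_pulled_back right_trace.family)
  show "R.pulled_back_trace (right_of_left_trace C T) (left_of_right_trace C (right_of_left_trace C T))"
    using assms by (intro left_of_right_trace_pulled_back right_trace.family right_trace_right_of_left)
qed (auto intro: LRunit_nat)

end

theorem theorem5:
  fixes C :: "('o, 'm) star_autonomous_data"
  assumes "star_autonomous_category C"
    and "cauchy_complete C"
  shows "(\<forall>Tr \<in> right_traces C. left_of_right_trace C Tr \<in> left_traces (par C)) \<and>
    (\<forall>T \<in> left_traces (par C). right_of_left_trace C T \<in> right_traces C) \<and>
    (\<forall>Tr \<in> right_traces C. right_of_left_trace C (left_of_right_trace C Tr) = Tr) \<and>
    (\<forall>T \<in> left_traces (par C). left_of_right_trace C (right_of_left_trace C T) = T)"
proof -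
  interpret star_autonomous_category C by fact
  show ?thesis
    unfolding left_traces_def right_traces_def
    using right_trace_left_of_right right_trace_right_of_left right_left_right left_right_left by blast
qed

end
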